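(* Let $D$ be an $\aleph_1$-complete filter on a cardinal $\kappa$, and $\langle\lambda_i:i<\kappa\rangle$ a sequence of regular cardinals $>(2^\kappa)^+$ such that $\|\langle\lambda_i:i<\kappa\rangle\|_{D+A}=\lambda$ for every $A\in D^+$. Let $\mu_i<\mathfrak{dp}^{3+}_{\lambda_i}$ for $i<\kappa$, and assume either $\mu=\mathrm{tcf}(\prod_{i<\kappa}\mu_i/D)$, or $\mu<\mathrm{Depth}^+(\prod_{i<\kappa}\mu_i,<_D)$ and $\mu>2^\kappa$. Then $\mu<\mathfrak{dp}^{3+}_\lambda$.
   Context: $D^+=\{A\subseteq\kappa:\kappa\setminus A\notin D\}$; $D+A$ is the filter generated by $D\cup\{A\}$. For an $\aleph_1$-complete filter $E$ on $\kappa$ and $f\in{}^\kappa\mathrm{Ord}$, the rank is $\|f\|_E=\bigcup\{\|g\|_E+1:g\in{}^\kappa\mathrm{Ord},\ g<_E f\}$ where $g<_E f$ means $\{i:g(i)<f(i)\}\in E$. For regular $\chi$, $\mathfrak{dp}^{3+}_\chi$ is the least $\nu$ such that there is no sequence $\langle A_\alpha:\alpha<\nu\rangle$ of unbounded subsets of $\chi$ with, for $\alpha<\beta$, $A_\beta\setminus A_\alpha$ unbounded and $A_\alpha\setminus A_\beta$ bounded. $\mathrm{tcf}$ is true cofinality; $\mathrm{Depth}^+(\prod\mu_i,<_D)$ is the least $\chi$ with no sequence of length $\chi$ in $\prod\mu_i$ strictly increasing under $<_D$. *)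

theory Defs
  imports Main
begin

unbundle cardinal_syntax

text \<open>
  An ordinal is a well-order relation, taken up to isomorphism; ordinals are compared, across types,
  by \<open><o\<close>, \<open>\<le>o\<close> and \<open>=o\<close>, and the elements of the field of a relation are the ordinals below it.
  An ordinal-valued function on the index set is a function \<open>f :: 'k \<Rightarrow> 'a rel\<close>. Every ordinal below
  an \<open>'a rel\<close> is itself represented by an \<open>'a rel\<close>, so no function \<open>g\<close> below \<open>f\<close> is missed by
  keeping the same type \<open>'a\<close>.
\<close>

text \<open>
  The least ordinal with property \<open>P\<close> among those represented on \<open>'b\<close>. Each use below comes with
  a lemma showing that \<open>'b\<close> is large enough for such an ordinal to exist.
\<close>

definition is_least_ordinal :: "('b rel \<Rightarrow> bool) \<Rightarrow> 'b rel \<Rightarrow> bool" where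
  "is_least_ordinal P r \<longleftrightarrow> Well_order r \<and> P r \<and> (\<forall>s. s <o r \<longrightarrow> \<not> P s)"

definition least_ordinal :: "('b rel \<Rightarrow> bool) \<Rightarrow> 'b rel" where
  "least_ordinal P = (SOME r. is_least_ordinal P r)"

lemma is_least_ordinal_least_ordinal:
  assumes "Well_order r" "P r"
  shows "is_least_ordinal P (least_ordinal P)"
proof -
  obtain m where "m \<in> {r. Well_order r \<and> P r}"
      and "\<And>y. (y, m) \<in> ordLess \<Longrightarrow> y \<notin> {r. Well_order r \<and> P r}"
    using wfE_min[OF wf_ordLess, of r "{r. Well_order r \<and> P r}"] assms by blast
  then have "is_least_ordinal P m"
    unfolding is_least_ordinal_def using ordLess_def by (auto simp: ordLess_def)
  then show ?thesis
    unfolding least_ordinal_def by (rule someI)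
qed

definition aleph1_complete :: "'k filter \<Rightarrow> bool" where
  "aleph1_complete D \<longleftrightarrow>
     (\<forall>P :: nat \<Rightarrow> 'k \<Rightarrow> bool.
        (\<forall>n. eventually (P n) D) \<longrightarrow> eventually (\<lambda>i. \<forall>n. P n i) D)"

definition positive_sets :: "'k filter \<Rightarrow> 'k set set" where
  "positive_sets D = {A. \<not> eventually (\<lambda>i. i \<in> UNIV - A) D}"

definition filter_plus :: "'k filter \<Rightarrow> 'k set \<Rightarrow> 'k filter" where
  "filter_plus D A = inf D (principal A)"

definition fun_less :: "'k filter \<Rightarrow> ('k \<Rightarrow> 'a rel) \<Rightarrow> ('k \<Rightarrow> 'a rel) \<Rightarrow> bool" where
  "fun_less E g f \<longleftrightarrow> eventually (\<lambda>i. g i <o f i) E"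

text \<open>
  The rank of \<open>f\<close> is the union of all \<open>rank E g + 1\<close> with \<open>g\<close> below \<open>f\<close>, i.e. the least ordinal
  strictly above all \<open>rank E g\<close>.
\<close>

definition rank :: "'k filter \<Rightarrow> ('k \<Rightarrow> 'a rel) \<Rightarrow> ('k \<Rightarrow> 'a rel) set rel" where
  "rank E = wfrec {(g, f). fun_less E g f}
     (\<lambda>rk f. least_ordinal (\<lambda>\<alpha>. \<forall>g. fun_less E g f \<longrightarrow> rk g <o \<alpha>))"

lemma wf_fun_less:
  fixes E :: "'k filter"
  assumes "aleph1_complete E" "E \<noteq> bot"
  shows "wf {(g, f :: 'k \<Rightarrow> 'a rel). fun_less E g f}"
proof (rule ccontr)
  assume "\<not> ?thesis"
  then obtain F :: "nat \<Rightarrow> 'k \<Rightarrow> 'a rel" where F: "\<And>n. fun_less E (F (Suc n)) (F n)"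
    unfolding wf_iff_no_infinite_down_chain by auto
  then have "eventually (\<lambda>i. \<forall>n. F (Suc n) i <o F n i) E"
    using assms(1)[unfolded aleph1_complete_def, rule_format, of "\<lambda>n i. F (Suc n) i <o F n i"]
    by (simp add: fun_less_def)
  then obtain i where "\<forall>n. F (Suc n) i <o F n i"
    using assms(2) eventually_happens' by blast
  then show False
    using wf_ordLess[unfolded wf_iff_no_infinite_down_chain] by auto
qed

lemma rank_spec:
  fixes E :: "'k filter" and f :: "'k \<Rightarrow> 'a rel"
  assumes E: "aleph1_complete E" "E \<noteq> bot"
  shows "is_least_ordinal (\<lambda>\<alpha>. \<forall>g. fun_less E g f \<longrightarrow> rank E g <o \<alpha>) (rank E f)"
proof -
  let ?R = "{(g, f :: 'k \<Rightarrow> 'a rel). fun_less E g f}"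
  let ?P = "\<lambda>f \<alpha>. \<forall>g. fun_less E g f \<longrightarrow> rank E g <o (\<alpha> :: ('k \<Rightarrow> 'a rel) set rel)"
  let ?U = "|UNIV :: ('k \<Rightarrow> 'a rel) set|"
  have wf: "wf ?R" by (rule wf_fun_less[OF E])
  have eq: "rank E f = least_ordinal (?P f)" for f
  proof -
    have "rank E f = least_ordinal (\<lambda>\<alpha>. \<forall>g. fun_less E g f \<longrightarrow> cut (rank E) ?R f g <o \<alpha>)"
      unfolding rank_def by (subst wfrec[OF wf]) simp
    moreover have "(\<lambda>\<alpha>. \<forall>g. fun_less E g f \<longrightarrow> cut (rank E) ?R f g <o \<alpha>) = ?P f"
      by (auto simp: cut_def)
    ultimately show ?thesis by simp
  qed
  have "is_least_ordinal (?P f) (rank E f) \<and>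
        (\<forall>\<beta> :: ('k \<Rightarrow> 'a rel) set rel. \<beta> <o rank E f \<longrightarrow> (\<exists>g :: 'k \<Rightarrow> 'a rel. rank E g =o \<beta>)) \<and>
        rank E f <o cardSuc ?U"
    using wf
  proof (induction f rule: wf_induct_rule)
    case (less f)
    have W: "Well_order (cardSuc ?U)"
      by (simp add: cardSuc_Well_order card_of_Card_order)
    have least: "is_least_ordinal (?P f) (rank E f)"
      unfolding eq[of f]
      by (rule is_least_ordinal_least_ordinal[OF W]) (use less in auto)
    then have wo: "Well_order (rank E f)" by (simp add: is_least_ordinal_def)
    have hit: "\<exists>g :: 'k \<Rightarrow> 'a rel. rank E g =o \<beta>" if \<beta>: "\<beta> <o rank E f" for \<beta> :: "('k \<Rightarrow> 'a rel) set rel"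
    proof -
      obtain g where g: "fun_less E g f" "\<not> rank E g <o \<beta>"
        using least \<beta> unfolding is_least_ordinal_def by blast
      have wog: "Well_order (rank E g)" using less g(1) by (auto simp: is_least_ordinal_def)
      have wob: "Well_order \<beta>" using \<beta> by (auto simp: ordLess_def)
      have "\<beta> \<le>o rank E g" using g(2) wog wob by (simp add: not_ordLess_iff_ordLeq)
      then consider "\<beta> <o rank E g" | "\<beta> =o rank E g"
        using ordLeq_iff_ordLess_or_ordIso by blast
      then show ?thesis
      proof cases
        case 1
        have "(g, f) \<in> ?R" using g(1) by simp
        from less[OF this] 1 show ?thesis by simp
      next
        case 2
        then show ?thesis using ordIso_symmetric by blast
      qed
    qed
    have "\<exists>g :: 'k \<Rightarrow> 'a rel. rank E g =o Restr (rank E f) (underS (rank E f) a)"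
      if "a \<in> Field (rank E f)" for a
      by (rule hit) (rule underS_Restr_ordLess[OF wo], use that in auto)
    then obtain G :: "('k \<Rightarrow> 'a rel) set \<Rightarrow> 'k \<Rightarrow> 'a rel" where G:
      "\<And>a. a \<in> Field (rank E f) \<Longrightarrow> rank E (G a) =o Restr (rank E f) (underS (rank E f) a)"
      by metis
    have "inj_on G (Field (rank E f))"
    proof (rule inj_onI)
      fix a b
      assume ab: "a \<in> Field (rank E f)" "b \<in> Field (rank E f)" "G a = G b"
      let ?r = "\<lambda>x. Restr (rank E f) (underS (rank E f) x)"
      have iso: "?r a =o ?r b"
        using G[OF ab(1)] G[OF ab(2)] ab(3) ordIso_symmetric ordIso_transitive by metis
      have less: "?r x <o ?r y" if xy: "(x, y) \<in> rank E f" "x \<noteq> y" for x y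
      proof -
        have REFL: "Refl (rank E f)" and TRANS: "trans (rank E f)" and ANTISYM: "antisym (rank E f)"
          using wo by (simp_all add: order_on_defs)
        have y: "y \<in> Field (rank E f)" using xy by (auto simp: Field_def)
        have sub: "underS (rank E f) y \<subseteq> Field (rank E f)"
          by (auto simp: underS_def Field_def)
        have woy: "Well_order (?r y)" using wo by (simp add: Well_order_Restr)
        have F: "Field (?r y) = underS (rank E f) y"
          using Refl_Field_Restr[OF REFL, of "underS (rank E f) y"] sub by blast
        have x: "x \<in> underS (rank E f) y" using xy by (auto simp: underS_def)
        have "underS (?r y) x = underS (rank E f) x"
          using x TRANS ANTISYM unfolding underS_def trans_def antisym_def by blast
        moreover have "underS (rank E f) x \<subseteq> underS (rank E f) y"
          using x TRANS ANTISYM unfolding underS_def trans_def antisym_def by blast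
        ultimately have "Restr (?r y) (underS (?r y) x) = ?r x" by blast
        moreover have "Restr (?r y) (underS (?r y) x) <o ?r y"
          by (rule underS_Restr_ordLess[OF woy]) (use x F in blast)
        ultimately show ?thesis by simp
      qed
      show "a = b"
      proof (rule ccontr)
        assume "a \<noteq> b"
        then have "?r a <o ?r b \<or> ?r b <o ?r a"
          using less wo_rel.TOTALS[of "rank E f"] wo ab(1,2) unfolding wo_rel_def by metis
        then show False
          using iso not_ordLess_ordIso ordIso_symmetric by blast
      qed
    qed
    then have "|Field (rank E f)| \<le>o |UNIV :: ('k \<Rightarrow> 'a rel) set|"
      using card_of_ordLeq by blast
    also have "|UNIV :: ('k \<Rightarrow> 'a rel) set| <o cardSuc ?U"
      by (simp add: cardSuc_greater card_of_Card_order)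
    finally have "|Field (rank E f)| <o cardSuc ?U" .
    then have "rank E f <o cardSuc ?U"
      by (meson W card_of_Field_ordIso card_of_mono2 cardSuc_Card_order card_of_Card_order
          not_ordLess_iff_ordLeq not_ordLess_ordLeq ordIso_iff_ordLeq ordLeq_transitive wo)
    with least hit show ?case by blast
  qed
  then show ?thesis by blast
qed

text \<open>
  \<open>cofinal A \<chi>\<close> is the library's "unbounded"; for \<open>A \<subseteq> Field \<chi>\<close> its negation says that some element of
  \<open>\<chi>\<close> is an upper bound of \<open>A\<close>. The regularity of \<open>\<chi>\<close> plays no role in the definition of \<open>dp3plus\<close>
  and is not built into it.
\<close>

definition is_dp3_sequence :: "'a rel \<Rightarrow> 'i rel \<Rightarrow> ('i \<Rightarrow> 'a set) \<Rightarrow> bool" where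
  "is_dp3_sequence \<chi> \<nu> A \<longleftrightarrow>
     (\<forall>\<alpha> \<in> Field \<nu>. A \<alpha> \<subseteq> Field \<chi> \<and> cofinal (A \<alpha>) \<chi>) \<and>
     (\<forall>\<alpha> \<beta>. (\<alpha>, \<beta>) \<in> \<nu> \<and> \<alpha> \<noteq> \<beta> \<longrightarrow>
        cofinal (A \<beta> - A \<alpha>) \<chi> \<and> \<not> cofinal (A \<alpha> - A \<beta>) \<chi>)"

definition dp3plus :: "'a rel \<Rightarrow> 'a set set rel" where
  "dp3plus \<chi> = least_ordinal (\<lambda>\<nu>. \<not> (\<exists>A. is_dp3_sequence \<chi> \<nu> A))"

lemma dp3plus_spec:
  "is_least_ordinal (\<lambda>\<nu>. \<not> (\<exists>A. is_dp3_sequence \<chi> \<nu> A)) (dp3plus (\<chi> :: 'a rel))"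
  unfolding dp3plus_def
proof (rule is_least_ordinal_least_ordinal)
  let ?W = "cardSuc |UNIV :: 'a set set|"
  show W: "Well_order ?W" by (simp add: cardSuc_Well_order card_of_Card_order)
  show "\<not> (\<exists>A. is_dp3_sequence \<chi> ?W A)"
  proof
    assume "\<exists>A. is_dp3_sequence \<chi> ?W A"
    then obtain A where A: "is_dp3_sequence \<chi> ?W A" by blast
    have ne: "A \<alpha> \<noteq> A \<beta>" if "(\<alpha>, \<beta>) \<in> ?W" "\<alpha> \<noteq> \<beta>" for \<alpha> \<beta>
      using A that unfolding is_dp3_sequence_def by (metis)
    have "inj_on A (Field ?W)"
    proof (rule inj_onI, rule ccontr)
      fix \<alpha> \<beta>
      assume "\<alpha> \<in> Field ?W" "\<beta> \<in> Field ?W" "A \<alpha> = A \<beta>" "\<alpha> \<noteq> \<beta>"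
      then show False
        using ne[of \<alpha> \<beta>] ne[of \<beta> \<alpha>] wo_rel.TOTALS[of ?W] W unfolding wo_rel_def by metis
    qed
    then have "|Field ?W| \<le>o |UNIV :: 'a set set|"
      using card_of_ordLeq by blast
    moreover have "?W =o |Field ?W|"
      by (simp add: cardSuc_Card_order card_of_Card_order card_of_Field_ordIso ordIso_symmetric)
    ultimately have "?W \<le>o |UNIV :: 'a set set|" by (rule ordIso_ordLeq_trans[rotated])
    then show False
      using cardSuc_greater[OF card_of_Card_order] not_ordLess_ordLeq by blast
  qed
qed

definition ord_prod :: "('k \<Rightarrow> 'm rel) \<Rightarrow> ('k \<Rightarrow> 'm) set" where
  "ord_prod m = {f. \<forall>i. f i \<in> Field (m i)}"

definition prod_less :: "'k filter \<Rightarrow> ('k \<Rightarrow> 'm rel) \<Rightarrow> ('k \<Rightarrow> 'm) \<Rightarrow> ('k \<Rightarrow> 'm) \<Rightarrow> bool" where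
  "prod_less D m f g \<longleftrightarrow> eventually (\<lambda>i. (f i, g i) \<in> m i \<and> f i \<noteq> g i) D"

definition prod_le :: "'k filter \<Rightarrow> ('k \<Rightarrow> 'm rel) \<Rightarrow> ('k \<Rightarrow> 'm) \<Rightarrow> ('k \<Rightarrow> 'm) \<Rightarrow> bool" where
  "prod_le D m f g \<longleftrightarrow> eventually (\<lambda>i. (f i, g i) \<in> m i) D"

definition is_increasing_sequence ::
    "'k filter \<Rightarrow> ('k \<Rightarrow> 'm rel) \<Rightarrow> 'n rel \<Rightarrow> ('n \<Rightarrow> 'k \<Rightarrow> 'm) \<Rightarrow> bool" where
  "is_increasing_sequence D m \<nu> F \<longleftrightarrow>
     (\<forall>\<alpha> \<in> Field \<nu>. F \<alpha> \<in> ord_prod m) \<and>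
     (\<forall>\<alpha> \<beta>. (\<alpha>, \<beta>) \<in> \<nu> \<and> \<alpha> \<noteq> \<beta> \<longrightarrow> prod_less D m (F \<alpha>) (F \<beta>))"

text \<open>
  The true cofinality need not exist, so it is a relation; its values are infinite regular cardinals
  (finite linear orders satisfy \<open>regularCard\<close> vacuously).
\<close>

definition has_tcf :: "'k filter \<Rightarrow> ('k \<Rightarrow> 'm rel) \<Rightarrow> 'n rel \<Rightarrow> bool" where
  "has_tcf D m \<mu> \<longleftrightarrow> Card_order \<mu> \<and> infinite (Field \<mu>) \<and> regularCard \<mu> \<and>
     (\<exists>F. is_increasing_sequence D m \<mu> F \<and>
          (\<forall>g \<in> ord_prod m. \<exists>\<alpha> \<in> Field \<mu>. prod_le D m g (F \<alpha>)))"

definition Depth_plus :: "'k filter \<Rightarrow> ('k \<Rightarrow> 'm rel) \<Rightarrow> ('k \<Rightarrow> 'm) set rel" where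
  "Depth_plus D m = least_ordinal (\<lambda>\<nu>. \<not> (\<exists>F. is_increasing_sequence D m \<nu> F))"

lemma Depth_plus_spec:
  fixes D :: "'k filter" and m :: "'k \<Rightarrow> 'm rel"
  assumes "D \<noteq> bot"
  shows "is_least_ordinal (\<lambda>\<nu>. \<not> (\<exists>F. is_increasing_sequence D m \<nu> F)) (Depth_plus D m)"
  unfolding Depth_plus_def
proof (rule is_least_ordinal_least_ordinal)
  let ?W = "cardSuc |UNIV :: ('k \<Rightarrow> 'm) set|"
  show W: "Well_order ?W" by (simp add: cardSuc_Well_order card_of_Card_order)
  show "\<not> (\<exists>F. is_increasing_sequence D m ?W F)"
  proof
    assume "\<exists>F. is_increasing_sequence D m ?W F"
    then obtain F where F: "is_increasing_sequence D m ?W F" by blast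
    have ne: "F \<alpha> \<noteq> F \<beta>" if "(\<alpha>, \<beta>) \<in> ?W" "\<alpha> \<noteq> \<beta>" for \<alpha> \<beta>
    proof
      assume "F \<alpha> = F \<beta>"
      then have "eventually (\<lambda>i. False) D"
        using F that unfolding is_increasing_sequence_def prod_less_def by force
      then show False using assms by simp
    qed
    have "inj_on F (Field ?W)"
    proof (rule inj_onI, rule ccontr)
      fix \<alpha> \<beta>
      assume "\<alpha> \<in> Field ?W" "\<beta> \<in> Field ?W" "F \<alpha> = F \<beta>" "\<alpha> \<noteq> \<beta>"
      then show False
        using ne[of \<alpha> \<beta>] ne[of \<beta> \<alpha>] wo_rel.TOTALS[of ?W] W unfolding wo_rel_def by metis
    qed
    then have "|Field ?W| \<le>o |UNIV :: ('k \<Rightarrow> 'm) set|"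
      using card_of_ordLeq by blast
    moreover have "?W =o |Field ?W|"
      by (simp add: cardSuc_Card_order card_of_Card_order card_of_Field_ordIso ordIso_symmetric)
    ultimately have "?W \<le>o |UNIV :: ('k \<Rightarrow> 'm) set|" by (rule ordIso_ordLeq_trans[rotated])
    then show False
      using cardSuc_greater[OF card_of_Card_order] not_ordLess_ordLeq by blast
  qed
qed

end

theory Submission
  imports Defs
begin

text \<open>
  Let \<open>S i a\<close> (\<open>a < \<mu>s i\<close>) be the unbounded sets given for \<open>lams i\<close>, and \<open>F \<alpha>\<close> (\<open>\<alpha> < \<mu>\<close>) an
  increasing sequence in the product of the \<open>\<mu>s i\<close>. One would like to send \<open>\<alpha>\<close> to the set of ranks
  of all functions in the product of the sets \<open>S i (F \<alpha> i)\<close>. This set is unbounded in \<open>lam\<close>.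
  Since \<open>lam\<close> is also the rank with respect to every \<open>D + A\<close>, a function of large rank exceeds any
  given function almost everywhere, so these sets increase modulo bounded sets. They need not
  increase strictly, because different functions may have the same rank. However, \<open>2\<^sup>\<kappa>\<close> functions of
  rank \<open>\<gamma>\<close> suffice for every function of rank \<open>\<gamma>\<close> to agree with one of them on a positive set. So
  one adds to the rank a label with \<open>2\<^sup>\<kappa>\<close> values that determines the function on a positive set,
  and \<open>lam\<close> absorbs the labels. This requires \<open>\<kappa>\<close> to be infinite; otherwise \<open>D\<close> has an atom \<open>{i}\<close>,
  and then \<open>lam\<close> is just \<open>lams i\<close>.
\<close>

section \<open>Well-orders and their initial segments\<close>

text \<open>The ordinal \<open>a\<close> below \<open>r\<close>, as a relation on the same type, so
  that elements and ordinals are compared by the same ordering.\<close>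

definition seg :: "'a rel \<Rightarrow> 'a \<Rightarrow> 'a rel" where
  "seg r a = Restr r (underS r a)"

lemma underS_imp_Field:
  assumes "b \<in> underS r a"
  shows "b \<in> Field r" "a \<in> Field r"
  using assms by (auto simp: underS_def Field_def)

lemma Well_order_le_iff:
  assumes "Well_order r" "a \<in> Field r"
  shows "(a, b) \<in> r \<longleftrightarrow> a = b \<or> a \<in> underS r b"
  using assms by (auto simp: underS_def order_on_defs refl_on_def)

lemma Well_order_trichotomy:
  assumes "Well_order r" "a \<in> Field r" "b \<in> Field r"
  obtains "a = b" | "a \<in> underS r b" | "b \<in> underS r a"
  using assms by (auto simp: underS_def order_on_defs total_on_def)

lemma underS_not_sym: "Well_order r \<Longrightarrow> a \<in> underS r b \<Longrightarrow> b \<notin> underS r a"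
  by (auto simp: underS_def order_on_defs antisym_def)

lemma underS_trans: "Well_order r \<Longrightarrow> a \<in> underS r b \<Longrightarrow> b \<in> underS r c \<Longrightarrow> a \<in> underS r c"
  unfolding underS_def order_on_defs trans_def antisym_def by blast

lemma underS_le_trans: "Well_order r \<Longrightarrow> a \<in> underS r b \<Longrightarrow> (b, c) \<in> r \<Longrightarrow> a \<in> underS r c"
  unfolding underS_def order_on_defs trans_def antisym_def by blast

lemma not_le_iff_underS:
  assumes "Well_order r" "a \<in> Field r" "b \<in> Field r"
  shows "(a, b) \<notin> r \<longleftrightarrow> b \<in> underS r a"
  using underS_not_sym[OF assms(1)] Well_order_trichotomy[OF assms] Well_order_le_iff[OF assms(1,2)]
  by (metis underS_notIn)

lemma underS_induct [consumes 1, case_names less]: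
  assumes "Well_order r" and "\<And>a. (\<And>b. b \<in> underS r a \<Longrightarrow> P b) \<Longrightarrow> P a"
  shows "P a"
proof -
  have "wf (r - Id)" using assms(1) by (simp add: well_order_on_def)
  then show ?thesis
  proof (induction a rule: wf_induct_rule)
    case (less a)
    show ?case by (rule assms(2)) (rule less, auto simp: underS_def)
  qed
qed

lemma Well_order_seg: "Well_order r \<Longrightarrow> Well_order (seg r a)"
  by (simp add: seg_def Well_order_Restr)

lemma seg_ordLess: "Well_order r \<Longrightarrow> a \<in> Field r \<Longrightarrow> seg r a <o r"
  unfolding seg_def by (rule underS_Restr_ordLess) auto

lemma ordLess_segE:
  assumes "s <o r"
  obtains a where "a \<in> Field r" "s =o seg r a"
  using assms ordLess_iff_ordIso_Restr[of r s] unfolding seg_def by (auto simp: ordLess_def)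

lemma Field_seg:
  assumes "Well_order r"
  shows "Field (seg r a) = underS r a"
  unfolding seg_def using assms
  by (intro Refl_Field_Restr2) (auto simp: order_on_defs underS_def Field_def)

lemma seg_seg:
  assumes "Well_order r" "b \<in> underS r a"
  shows "seg (seg r a) b = seg r b"
  using assms underS_trans[OF assms(1) _ assms(2)] unfolding seg_def underS_def by auto

lemma seg_mono: "Well_order r \<Longrightarrow> b \<in> underS r a \<Longrightarrow> seg r b <o seg r a"
  using seg_ordLess[OF Well_order_seg, of r b a] by (simp add: Field_seg seg_seg)

lemma ordLess_seg_segE:
  assumes "Well_order r" "s <o seg r a"
  obtains b where "b \<in> underS r a" "s =o seg r b"
  using assms ordLess_segE[OF assms(2)] by (metis Field_seg seg_seg)

lemma seg_less_iff:
  assumes "Well_order r" "a \<in> Field r" "b \<in> Field r"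
  shows "seg r a <o seg r b \<longleftrightarrow> a \<in> underS r b"
  by (metis assms Well_order_trichotomy seg_mono ordLess_irreflexive ordLess_transitive)

lemma seg_le_iff:
  assumes "Well_order r" "a \<in> Field r" "b \<in> Field r"
  shows "seg r a \<le>o seg r b \<longleftrightarrow> (a, b) \<in> r"
  using seg_less_iff[OF assms(1,3,2)] not_le_iff_underS[OF assms]
    not_ordLeq_iff_ordLess[OF Well_order_seg Well_order_seg, OF assms(1,1)] by blast

text \<open>
  \<open>Q a x\<close> says that \<open>x\<close> represents the element \<open>a\<close>, not necessarily uniquely. Both strictly monotone maps
  and rank functions are instances.
\<close>

lemma ordLeq_by_representatives:
  fixes r :: "'a rel" and s :: "'b rel" and v :: "'x \<Rightarrow> 'c rel"
  assumes r: "Well_order r" and s: "Well_order s"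
    and ex: "\<And>a. a \<in> Field r \<Longrightarrow> \<exists>x. Q a x"
    and v: "\<And>a x. Q a x \<Longrightarrow> v x <o s"
    and step: "\<And>a x b. Q a x \<Longrightarrow> b \<in> underS r a \<Longrightarrow> \<exists>y. Q b y \<and> v y <o v x"
  shows "r \<le>o s" and "\<And>a x. Q a x \<Longrightarrow> seg r a \<le>o v x"
proof -
  have wov: "Well_order (v x)" if "Q a x" for a x
    using v[OF that] by (auto simp: ordLess_def)
  show seg: "seg r a \<le>o v x" if "Q a x" for a x
    using r that
  proof (induction a arbitrary: x rule: underS_induct)
    case (less a)
    show ?case
    proof (rule ccontr)
      assume "\<not> ?thesis"
      \<comment> \<open>Otherwise \<open>v x\<close> is isomorphic to the segment of some
        \<open>b\<close> below \<open>a\<close>, and \<open>step\<close> gives a representative of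
        \<open>b\<close> whose value is too small for the induction hypothesis.\<close>
      then have "v x <o seg r a"
        using wov[OF less.prems] Well_order_seg[OF r] by (simp add: not_ordLeq_iff_ordLess)
      then obtain b where b: "b \<in> underS r a" "v x =o seg r b"
        using ordLess_seg_segE[OF r] by blast
      obtain y where y: "Q b y" "v y <o v x" using step[OF less.prems b(1)] by blast
      have "v y <o seg r b" using y(2) b(2) by (rule ordLess_ordIso_trans)
      then show False using less.IH[OF b(1) y(1)] not_ordLeq_ordLess by blast
    qed
  qed
  show "r \<le>o s"
  proof (rule ccontr)
    assume "\<not> ?thesis"
    then have "s <o r" using r s by (simp add: not_ordLeq_iff_ordLess)
    then obtain a where a: "a \<in> Field r" "s =o seg r a" by (rule ordLess_segE)
    obtain x where x: "Q a x" using ex[OF a(1)] by blast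
    have "s \<le>o v x" using a(2) seg[OF x] by (rule ordIso_ordLeq_trans)
    then show False using v[OF x] not_ordLeq_ordLess by blast
  qed
qed

lemma ordLeq_if_strict_mono:
  assumes r: "Well_order r" and s: "Well_order s"
    and F: "\<And>a. a \<in> Field r \<Longrightarrow> h a \<in> Field s"
    and m: "\<And>a b. b \<in> underS r a \<Longrightarrow> h b \<in> underS s (h a)"
  shows "r \<le>o s"
proof (rule ordLeq_by_representatives[OF r s, where Q = "\<lambda>a x. a \<in> Field r \<and> x = h a" and v = "seg s"])
  fix a x b assume "a \<in> Field r \<and> x = h a" "b \<in> underS r a"
  then show "\<exists>y. (b \<in> Field r \<and> y = h b) \<and> seg s y <o seg s x"
    using m seg_mono[OF s] underS_imp_Field(1) by metis
qed (use F seg_ordLess[OF s] in auto)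

lemma ordLeq_strict_monoE:
  assumes "r \<le>o s"
  obtains h where "\<And>a. a \<in> Field r \<Longrightarrow> h a \<in> Field s"
    and "\<And>a b. b \<in> underS r a \<Longrightarrow> h b \<in> underS s (h a)"
proof -
  obtain h where h: "embed r s h" and r: "Well_order r"
    using assms by (auto simp: ordLeq_def)
  have inj: "inj_on h (Field r)" using embed_inj_on[OF r h] .
  have F: "\<And>a. a \<in> Field r \<Longrightarrow> h a \<in> Field s" using embed_Field[OF h] by blast
  have "h b \<in> underS s (h a)" if "b \<in> underS r a" for a b
    using embed_compat[OF h] inj underS_imp_Field[OF that] that
    by (auto simp: compat_def underS_def inj_on_def)
  with F that show thesis by blast
qed

lemma ordIso_strict_monoE:
  assumes "r =o s"
  obtains h where "h ` Field r = Field s" "inj_on h (Field r)"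
    and "\<And>a b. a \<in> Field r \<Longrightarrow> b \<in> Field r \<Longrightarrow> h b \<in> underS s (h a) \<longleftrightarrow> b \<in> underS r a"
proof -
  obtain h where h: "iso r s h" and r: "Well_order r" and s: "Well_order s"
    using assms by (auto simp: ordIso_def)
  have bij: "bij_betw h (Field r) (Field s)" and e: "embed r s h"
    using h by (auto simp: iso_def)
  have inj: "inj_on h (Field r)" using bij by (simp add: bij_betw_def)
  have m: "h b \<in> underS s (h a)" if "b \<in> underS r a" for a b
    using embed_compat[OF e] inj underS_imp_Field[OF that] that
    by (auto simp: compat_def underS_def inj_on_def)
  show thesis
  proof (rule that)
    fix a b assume ab: "a \<in> Field r" "b \<in> Field r"
    show "h b \<in> underS s (h a) \<longleftrightarrow> b \<in> underS r a"
      using Well_order_trichotomy[OF r ab] m underS_not_sym[OF s] underS_notIn by metis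
  qed (use bij in \<open>auto simp: bij_betw_def\<close>)
qed

section \<open>Lexicographic products\<close>

text \<open>The ordinal product of \<open>w\<close> and \<open>r\<close>: a copy of \<open>w\<close>
  for each element of \<open>r\<close>. The minor coordinate will hold labels, so that unbounded
  sets can be built by raising the first coordinate alone.\<close>

definition lex_ord :: "'a rel \<Rightarrow> 'b rel \<Rightarrow> ('a \<times> 'b) rel" where
  "lex_ord r w = {((a, s), (b, t)).
     (a \<in> underS r b \<and> s \<in> Field w \<and> t \<in> Field w) \<or> (a = b \<and> a \<in> Field r \<and> (s, t) \<in> w)}"

lemma
  assumes r: "Well_order r" and w: "Well_order w"
  shows Field_lex_ord: "Field (lex_ord r w) = Field r \<times> Field w"
    and underS_lex_ord: "(a, s) \<in> underS (lex_ord r w) (b, t) \<longleftrightarrow>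
      (a \<in> underS r b \<and> s \<in> Field w \<and> t \<in> Field w) \<or> (a = b \<and> a \<in> Field r \<and> s \<in> underS w t)"
    and Well_order_lex_ord: "Well_order (lex_ord r w)"
proof -
  let ?L = "lex_ord r w"
  have reflw: "(s, s) \<in> w" if "s \<in> Field w" for s
    using w that by (auto simp: order_on_defs refl_on_def)
  have "(a, s) \<in> Field ?L" if "a \<in> Field r" "s \<in> Field w" for a s
  proof -
    have "((a, s), (a, s)) \<in> ?L" using that reflw by (simp add: lex_ord_def)
    then show ?thesis by (auto simp: Field_def)
  qed
  moreover have "Field ?L \<subseteq> Field r \<times> Field w"
    by (auto simp: Field_def lex_ord_def underS_def)
  ultimately show F: "Field ?L = Field r \<times> Field w" by auto
  show U: "(a, s) \<in> underS ?L (b, t) \<longleftrightarrow>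
      (a \<in> underS r b \<and> s \<in> Field w \<and> t \<in> Field w) \<or> (a = b \<and> a \<in> Field r \<and> s \<in> underS w t)"
    for a s b t
    by (auto simp: lex_ord_def underS_def)
  have "Refl ?L" unfolding F using reflw by (auto simp: refl_on_def lex_ord_def)
  moreover have "?L \<subseteq> Field ?L \<times> Field ?L" by (auto simp: Field_def)
  moreover have "trans ?L"
  proof (rule transI)
    fix x y z assume xy: "(x, y) \<in> ?L" and yz: "(y, z) \<in> ?L"
    obtain a s b t c u where e: "x = (a, s)" "y = (b, t)" "z = (c, u)" by (cases x, cases y, cases z)
    have tw: "trans w" using w by (simp add: order_on_defs)
    have "s \<in> Field w" "u \<in> Field w" using xy yz by (auto simp: e lex_ord_def Field_def)
    moreover have "a \<in> underS r c \<or> a = c \<and> a \<in> Field r \<and> (s, u) \<in> w"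
      using xy yz underS_trans[OF r, of a b c] transD[OF tw, of s t u]
      unfolding e lex_ord_def by blast
    ultimately show "(x, z) \<in> ?L" unfolding e lex_ord_def by blast
  qed
  moreover have "antisym ?L"
  proof (rule antisymI)
    fix x y assume "(x, y) \<in> ?L" "(y, x) \<in> ?L"
    moreover have "antisym w" using w by (simp add: order_on_defs)
    ultimately show "x = y"
      using underS_not_sym[OF r]
      by (cases x; cases y) (auto simp: lex_ord_def underS_def dest: antisymD)
  qed
  moreover have "Total ?L"
  proof -
    have tw: "total_on (Field w) w" using w by (simp add: order_on_defs)
    have "(x, y) \<in> ?L \<or> (y, x) \<in> ?L" if "x \<in> Field r \<times> Field w" "y \<in> Field r \<times> Field w" "x \<noteq> y" for x y
    proof -
      obtain a s b t where xy: "x = (a, s)" "y = (b, t)" by (cases x, cases y)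
      show ?thesis
      proof (rule Well_order_trichotomy[OF r, of a b])
        assume "a = b"
        with xy that tw show ?thesis by (auto simp: lex_ord_def total_on_def)
      qed (use xy that in \<open>auto simp: lex_ord_def\<close>)
    qed
    then show ?thesis unfolding total_on_def F by blast
  qed
  moreover have "wf (?L - Id)"
  proof (rule wf_subset)
    show "wf ((r - Id) <*lex*> (w - Id))"
      using r w by (intro wf_lex_prod) (auto simp: well_order_on_def)
    show "?L - Id \<subseteq> (r - Id) <*lex*> (w - Id)"
      by (auto simp: lex_ord_def underS_def)
  qed
  ultimately show "Well_order ?L" by (simp add: order_on_defs)
qed

text \<open>By regularity every proper initial segment of the product has fewer than
  \<open>r\<close> elements, so \<open>r\<close> is isomorphic to none of them.\<close>

lemma lex_ord_le_Card_order:
  assumes r: "Card_order r" "infinite (Field r)" "regularCard r"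
    and w: "Well_order w" "|Field w| <o r"
  shows "lex_ord r w \<le>o r"
proof (rule ccontr)
  have wr: "Well_order r" using r(1) by (simp add: card_order_on_def)
  note L = Well_order_lex_ord[OF wr w(1)]
  assume "\<not> ?thesis"
  then have "r <o lex_ord r w" using wr L by (simp add: not_ordLeq_iff_ordLess)
  then obtain p where p: "p \<in> Field (lex_ord r w)" "r =o seg (lex_ord r w) p"
    by (rule ordLess_segE)
  obtain b t where bt: "p = (b, t)" "b \<in> Field r" "t \<in> Field w"
    using p(1) by (cases p) (auto simp: Field_lex_ord[OF wr w(1)])
  \<comment> \<open>The segment below \<open>(b, t)\<close> also meets the copy of \<open>w\<close>
    at \<open>b\<close>. An infinite cardinal is a limit, so some \<open>c\<close> strictly above
    \<open>b\<close> covers that copy as well.\<close>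
  obtain c where c: "c \<in> Field r" "b \<in> underS r c"
    using infinite_Card_order_limit[OF r(1,2) bt(2)] by (auto simp: underS_def)
  have sub: "underS (lex_ord r w) p \<subseteq> underS r c \<times> Field w"
    using underS_trans[OF wr _ c(2)] c(2) underS_imp_Field(1)[of _ w]
    by (auto simp: bt(1) underS_lex_ord[OF wr w(1)])
  have "|underS r c| <o r" using card_of_underS[OF r(1) c(1)] .
  then have "|underS r c \<times> Field w| <o r"
    using stable_elim[OF regularCard_stable[OF r], of "underS r c" "\<lambda>_. Field w"] w(2) by simp
  then have "|underS (lex_ord r w) p| <o r"
    using card_of_mono1[OF sub] ordLeq_ordLess_trans by blast
  moreover have "r =o |Field r|"
    using card_of_Field_ordIso[OF r(1)] by (rule ordIso_symmetric)
  moreover have "|Field r| =o |underS (lex_ord r w) p|"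
    using card_of_cong[OF p(2)] by (simp add: Field_seg[OF L])
  ultimately show False
    using not_ordLess_ordIso ordIso_transitive ordIso_symmetric by metis
qed

section \<open>The rank of an ordinal-valued function\<close>

lemma eventually_filter_plus:
  "eventually P (filter_plus D A) \<longleftrightarrow> eventually (\<lambda>i. i \<in> A \<longrightarrow> P i) D"
  by (simp add: filter_plus_def eventually_inf_principal)

lemma filter_plus_neq_bot_iff: "filter_plus D A \<noteq> bot \<longleftrightarrow> A \<in> positive_sets D"
  by (simp add: trivial_limit_def eventually_filter_plus positive_sets_def)

lemma filter_plus_le: "filter_plus D A \<le> D"
  by (simp add: filter_plus_def)

lemma filter_plus_antimono: "A \<subseteq> B \<Longrightarrow> filter_plus D A \<le> filter_plus D B"
  unfolding filter_plus_def by (intro inf_mono) auto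

lemma aleph1_complete_filter_plus:
  assumes "aleph1_complete D"
  shows "aleph1_complete (filter_plus D A)"
  unfolding aleph1_complete_def eventually_filter_plus
proof (intro allI impI)
  fix P :: "nat \<Rightarrow> 'a \<Rightarrow> bool"
  assume "\<forall>n. eventually (\<lambda>i. i \<in> A \<longrightarrow> P n i) D"
  then have "eventually (\<lambda>i. \<forall>n. i \<in> A \<longrightarrow> P n i) D"
    using assms unfolding aleph1_complete_def by fast
  then show "eventually (\<lambda>i. i \<in> A \<longrightarrow> (\<forall>n. P n i)) D"
    by eventually_elim blast
qed

lemma positive_sets_mono: "A \<in> positive_sets D \<Longrightarrow> A \<subseteq> B \<Longrightarrow> B \<in> positive_sets D"
  unfolding positive_sets_def by simp (metis (mono_tags, lifting) eventually_mono subsetD)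

lemma Well_order_rank:
  fixes f :: "'k \<Rightarrow> 'a rel"
  assumes "aleph1_complete E" "E \<noteq> bot"
  shows "Well_order (rank E f)"
  using rank_spec[OF assms, of f] by (simp add: is_least_ordinal_def)

lemma rank_less:
  fixes f g :: "'k \<Rightarrow> 'a rel"
  assumes "aleph1_complete E" "E \<noteq> bot" "fun_less E g f"
  shows "rank E g <o rank E f"
  using rank_spec[OF assms(1,2), of f] assms(3) by (simp add: is_least_ordinal_def)

lemma rank_hit:
  fixes f :: "'k \<Rightarrow> 'a rel"
  assumes E: "aleph1_complete E" "E \<noteq> bot" and \<beta>: "\<beta> <o rank E f"
  obtains g where "fun_less E g f" "\<beta> \<le>o rank E g"
proof -
  \<comment> \<open>Minimality of the rank speaks only of relations on its own type, so
    \<open>\<beta>\<close> is replaced by an isomorphic segment of the rank.\<close>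
  obtain a where a: "a \<in> Field (rank E f)" "\<beta> =o seg (rank E f) a"
    using \<beta> by (rule ordLess_segE)
  note wo = Well_order_rank[OF E]
  have "seg (rank E f) a <o rank E f" using seg_ordLess[OF wo a(1)] .
  then obtain g where g: "fun_less E g f" "\<not> rank E g <o seg (rank E f) a"
    using rank_spec[OF E, of f] unfolding is_least_ordinal_def by blast
  then have "seg (rank E f) a \<le>o rank E g"
    by (simp add: not_ordLess_iff_ordLeq Well_order_seg wo)
  with a(2) have "\<beta> \<le>o rank E g" by (rule ordIso_ordLeq_trans)
  with g(1) show thesis by (rule that)
qed

lemma rank_mono:
  fixes f g :: "'k \<Rightarrow> 'a rel"
  assumes E: "aleph1_complete E" "E \<noteq> bot" and le: "eventually (\<lambda>i. f i \<le>o g i) E"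
  shows "rank E f \<le>o rank E g"
proof (rule ccontr)
  assume "\<not> ?thesis"
  then have "rank E g <o rank E f"
    by (simp add: not_ordLeq_iff_ordLess Well_order_rank[OF E])
  then obtain h where h: "fun_less E h f" "rank E g \<le>o rank E h"
    using rank_hit[OF E] by blast
  have "fun_less E h g"
    using h(1) le unfolding fun_less_def by eventually_elim (rule ordLess_ordLeq_trans)
  then show False using rank_less[OF E] h(2) not_ordLeq_ordLess by blast
qed

text \<open>A finer filter puts more functions below \<open>f\<close>. If the rank dropped, some
  \<open>h\<close> below \<open>f\<close> modulo \<open>D\<close> would have \<open>D\<close>-rank
  at least \<open>rank E f\<close>; its \<open>E\<close>-rank is no smaller by induction, yet it
  lies below \<open>rank E f\<close>.\<close>

lemma rank_finer_filter:
  fixes f :: "'k \<Rightarrow> 'a rel"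
  assumes D: "aleph1_complete D" and E: "aleph1_complete E" "E \<noteq> bot" and le: "E \<le> D"
  shows "rank D f \<le>o rank E f"
proof -
  have D': "D \<noteq> bot" using E(2) le by (auto simp: le_bot)
  show ?thesis
    using wf_fun_less[OF D D']
  proof (induction f rule: wf_induct_rule)
    case (less f)
    show ?case
    proof (rule ccontr)
      assume "\<not> ?thesis"
      then have "rank E f <o rank D f"
        by (simp add: not_ordLeq_iff_ordLess Well_order_rank[OF D D'] Well_order_rank[OF E])
      then obtain h where h: "fun_less D h f" "rank E f \<le>o rank D h"
        using rank_hit[OF D D'] by blast
      have "rank D h \<le>o rank E h" using less h(1) by simp
      moreover have "rank E h <o rank E f"
        using h(1) le by (intro rank_less[OF E]) (auto simp: fun_less_def le_filter_def)
      ultimately show False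
        using h(2) by (meson not_ordLeq_ordLess ordLeq_transitive)
    qed
  qed
qed

text \<open>Witnesses \<open>g n\<close> for the ranks on the sets \<open>Q n\<close> are glued to
  one \<open>h\<close> below \<open>f\<close>, whose rank on each positive piece is at least
  \<open>\<beta>\<close>. If \<open>rank D h\<close> were below \<open>\<beta>\<close>, the
  induction hypothesis for the value \<open>rank D h\<close> and the function \<open>h\<close>
  itself would give \<open>rank D h <o rank D h\<close>.\<close>

lemma rank_greater_if_countable_cover:
  fixes f :: "'k \<Rightarrow> 'a rel" and \<beta> :: "('k \<Rightarrow> 'a rel) set rel"
  assumes D: "aleph1_complete D" "D \<noteq> bot"
    and "eventually (\<lambda>i. \<exists>n::nat. i \<in> Q n) D"
    and "\<And>n. Q n \<in> positive_sets D \<Longrightarrow> \<beta> <o rank (filter_plus D (Q n)) f"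
  shows "\<beta> <o rank D f"
  using wf_ordLess assms(3,4)
proof (induction \<beta> arbitrary: f Q rule: wf_induct_rule)
  case (less \<beta>)
  note DQ = aleph1_complete_filter_plus[OF D(1)]
  have "\<exists>g. Q n \<in> positive_sets D \<longrightarrow>
      fun_less (filter_plus D (Q n)) g f \<and> \<beta> \<le>o rank (filter_plus D (Q n)) g" for n
    using less.prems(2)[of n] rank_hit[OF DQ] by (metis filter_plus_neq_bot_iff)
  then obtain g where g: "\<And>n. Q n \<in> positive_sets D \<Longrightarrow>
      fun_less (filter_plus D (Q n)) (g n) f \<and> \<beta> \<le>o rank (filter_plus D (Q n)) (g n)"
    by metis
  \<comment> \<open>Taking the first index makes the pieces disjoint, so that the gluing is well
    defined.\<close>
  define N where "N i = (LEAST n. i \<in> Q n)" for i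
  define R where "R n = {i \<in> Q n. N i = n}" for n
  define h where "h i = g (N i) i" for i
  have cover: "eventually (\<lambda>i. i \<in> R (N i)) D"
    using less.prems(1) by eventually_elim (auto simp: R_def N_def intro: LeastI)
  have "eventually (\<lambda>i. i \<in> Q n \<longrightarrow> g n i <o f i) D" for n
  proof (cases "Q n \<in> positive_sets D")
    case True
    with g show ?thesis by (auto simp: fun_less_def eventually_filter_plus)
  next
    case False
    then show ?thesis by (auto simp: positive_sets_def elim: eventually_mono)
  qed
  then have "eventually (\<lambda>i. \<forall>n. i \<in> Q n \<longrightarrow> g n i <o f i) D"
    using D(1) unfolding aleph1_complete_def by fast
  with cover have "fun_less D h f"
    unfolding fun_less_def by eventually_elim (auto simp: R_def h_def)
  then have hf: "rank D h <o rank D f" by (rule rank_less[OF D])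
  have ge: "\<beta> \<le>o rank (filter_plus D (R n)) h" if "R n \<in> positive_sets D" for n
  proof -
    have Rn: "filter_plus D (R n) \<noteq> bot" using that filter_plus_neq_bot_iff by blast
    have sub: "R n \<subseteq> Q n" by (auto simp: R_def)
    then have pos: "Q n \<in> positive_sets D" using positive_sets_mono[OF that] by blast
    have "\<beta> \<le>o rank (filter_plus D (Q n)) (g n)" using g[OF pos] by blast
    also have "rank (filter_plus D (Q n)) (g n) \<le>o rank (filter_plus D (R n)) (g n)"
      by (rule rank_finer_filter[OF DQ DQ Rn filter_plus_antimono[OF sub]])
    also have "rank (filter_plus D (R n)) (g n) \<le>o rank (filter_plus D (R n)) h"
    proof (rule rank_mono[OF DQ Rn])
      have "eventually (\<lambda>i. i \<in> Q n \<longrightarrow> g n i <o f i) D"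
        using g[OF pos] by (auto simp: fun_less_def eventually_filter_plus)
      then show "eventually (\<lambda>i. g n i \<le>o h i) (filter_plus D (R n))"
        unfolding eventually_filter_plus
        by eventually_elim (auto simp: R_def h_def ordLess_def intro: ordLeq_reflexive)
    qed
    finally show ?thesis .
  qed
  \<comment> \<open>Properness of \<open>D\<close> yields a positive piece; the comparison on that
    piece shows that \<open>\<beta>\<close> is a well-order.\<close>
  have "\<exists>n. R n \<in> positive_sets D"
  proof (rule ccontr)
    assume "\<nexists>n. R n \<in> positive_sets D"
    then have "\<forall>n. eventually (\<lambda>i. i \<notin> R n) D" by (simp add: positive_sets_def)
    then have "eventually (\<lambda>i. \<forall>n. i \<notin> R n) D"
      using D(1) unfolding aleph1_complete_def by fast
    with cover have "eventually (\<lambda>i. False) D" by eventually_elim blast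
    then show False using D(2) by (simp add: trivial_limit_def)
  qed
  then have wo: "Well_order \<beta>" using ge by (auto simp: ordLeq_def)
  have "\<beta> \<le>o rank D h"
  proof (rule ccontr)
    assume "\<not> ?thesis"
    then have l: "rank D h <o \<beta>"
      using wo by (simp add: not_ordLeq_iff_ordLess Well_order_rank[OF D])
    have "rank D h <o rank D h"
    proof (rule less.IH)
      show "(rank D h, \<beta>) \<in> ordLess" by (rule l)
      show "eventually (\<lambda>i. \<exists>n. i \<in> R n) D" using cover by eventually_elim blast
      show "rank D h <o rank (filter_plus D (R n)) h" if "R n \<in> positive_sets D" for n
        using l ge[OF that] by (rule ordLess_ordLeq_trans)
    qed
    then show False using ordLess_irreflexive by blast
  qed
  then show ?case using hf by (rule ordLeq_ordLess_trans)
qed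

text \<open>Elements of well-orders stand for the initial segments they determine.\<close>

definition rank_elem :: "'k filter \<Rightarrow> ('k \<Rightarrow> 'a rel) \<Rightarrow> ('k \<Rightarrow> 'a) \<Rightarrow> ('k \<Rightarrow> 'a rel) set rel" where
  "rank_elem E r f = rank E (\<lambda>i. seg (r i) (f i))"

lemma rank_elem_less:
  fixes r :: "'k \<Rightarrow> 'a rel"
  assumes "aleph1_complete E" "E \<noteq> bot" "\<And>i. Well_order (r i)"
    and "eventually (\<lambda>i. f i \<in> underS (r i) (g i)) E"
  shows "rank_elem E r f <o rank_elem E r g"
  unfolding rank_elem_def
  by (rule rank_less[OF assms(1,2)])
    (use assms(4) in \<open>auto simp: fun_less_def elim!: eventually_mono intro: seg_mono[OF assms(3)]\<close>)

lemma rank_elem_mono: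
  fixes r :: "'k \<Rightarrow> 'a rel"
  assumes "aleph1_complete E" "E \<noteq> bot" "\<And>i. Well_order (r i)"
    and "eventually (\<lambda>i. (f i, g i) \<in> r i) E"
  shows "rank_elem E r f \<le>o rank_elem E r g"
  unfolding rank_elem_def
proof (rule rank_mono[OF assms(1,2)])
  show "eventually (\<lambda>i. seg (r i) (f i) \<le>o seg (r i) (g i)) E"
    using assms(4)
  proof eventually_elim
    case (elim i)
    then show ?case using seg_le_iff[OF assms(3), of "f i" i "g i"] by (auto simp: Field_def)
  qed
qed

lemma rank_elem_less_rank:
  fixes r :: "'k \<Rightarrow> 'a rel"
  assumes "aleph1_complete E" "E \<noteq> bot" "\<And>i. Well_order (r i)" "f \<in> ord_prod r"
  shows "rank_elem E r f <o rank E r"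
  unfolding rank_elem_def
  by (rule rank_less[OF assms(1,2)])
    (use assms(3,4) in \<open>auto simp: fun_less_def ord_prod_def seg_ordLess\<close>)

text \<open>Returns from ordinal-valued functions to functions choosing elements. Where
  \<open>g i\<close> is not below \<open>r i\<close>, which is negligible for \<open>E\<close>, any
  element of the field serves.\<close>

lemma rank_hit_elem:
  fixes r :: "'k \<Rightarrow> 'a rel"
  assumes E: "aleph1_complete E" "E \<noteq> bot" and r: "\<And>i. Well_order (r i)" "\<And>i. Field (r i) \<noteq> {}"
    and \<beta>: "\<beta> <o rank E r"
  obtains f where "f \<in> ord_prod r" "\<beta> \<le>o rank_elem E r f"
proof -
  obtain g where g: "fun_less E g r" "\<beta> \<le>o rank E g" using rank_hit[OF E \<beta>] .
  have "\<exists>a. a \<in> Field (r i) \<and> (g i <o r i \<longrightarrow> g i =o seg (r i) a)" for i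
    using r(2)[of i] by (cases "g i <o r i") (auto elim: ordLess_segE)
  then obtain f where f: "\<And>i. f i \<in> Field (r i)" "\<And>i. g i <o r i \<Longrightarrow> g i =o seg (r i) (f i)"
    by metis
  have "rank E g \<le>o rank_elem E r f"
    unfolding rank_elem_def
    by (rule rank_mono[OF E])
      (use g(1) f(2) in \<open>auto simp: fun_less_def elim!: eventually_mono intro: ordIso_imp_ordLeq\<close>)
  with g(2) have "\<beta> \<le>o rank_elem E r f" by (rule ordLeq_transitive)
  with f(1) show thesis by (intro that[of f]) (auto simp: ord_prod_def)
qed

lemma rank_elem_hit:
  fixes r :: "'k \<Rightarrow> 'a rel"
  assumes E: "aleph1_complete E" "E \<noteq> bot" and r: "\<And>i. Well_order (r i)"
    and f: "f \<in> ord_prod r" and \<beta>: "\<beta> <o rank_elem E r f"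
  obtains g where "g \<in> ord_prod r" "eventually (\<lambda>i. g i \<in> underS (r i) (f i)) E"
    "\<beta> \<le>o rank_elem E r g"
proof -
  obtain h where h: "fun_less E h (\<lambda>i. seg (r i) (f i))" "\<beta> \<le>o rank E h"
    using rank_hit[OF E \<beta>[unfolded rank_elem_def]] .
  have "\<exists>a. a \<in> Field (r i) \<and>
      (h i <o seg (r i) (f i) \<longrightarrow> a \<in> underS (r i) (f i) \<and> h i =o seg (r i) a)" for i
  proof (cases "h i <o seg (r i) (f i)")
    case True
    then show ?thesis using ordLess_seg_segE[OF r] underS_imp_Field(1) by metis
  next
    case False
    with f show ?thesis by (auto simp: ord_prod_def)
  qed
  then obtain g where g: "\<And>i. g i \<in> Field (r i)"
      "\<And>i. h i <o seg (r i) (f i) \<Longrightarrow> g i \<in> underS (r i) (f i) \<and> h i =o seg (r i) (g i)"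
    by metis
  have "rank E h \<le>o rank_elem E r g"
    unfolding rank_elem_def
    by (rule rank_mono[OF E])
      (use h(1) g(2) in \<open>auto simp: fun_less_def elim!: eventually_mono intro: ordIso_imp_ordLeq\<close>)
  with h(2) have "\<beta> \<le>o rank_elem E r g" by (rule ordLeq_transitive)
  moreover have "eventually (\<lambda>i. g i \<in> underS (r i) (f i)) E"
    using h(1) unfolding fun_less_def by eventually_elim (use g(2) in blast)
  ultimately show thesis using g(1) by (intro that[of g]) (auto simp: ord_prod_def)
qed

section \<open>Few functions of a given rank, up to equality on a positive set\<close>

text \<open>A list is the history of an approximation, latest stage first. In each pair the first
  set guides the choice of a function and the second tells where the bound is replaced by it. The
  bound is thus rebuilt from sets alone, without the function being approximated.\<close>

primrec refine :: "(('k \<Rightarrow> 'a option) \<Rightarrow> 'k set \<Rightarrow> 'k \<Rightarrow> 'a) \<Rightarrow> ('k set \<times> 'k set) list \<Rightarrow> 'k \<Rightarrow> 'a option" where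
  "refine ch [] = (\<lambda>i. None)"
| "refine ch (p # l) =
    (\<lambda>i. if i \<in> snd p then Some (ch (refine ch l) (fst p) i) else refine ch l i)"

text \<open>The value \<open>None\<close> of an upper bound \<open>c\<close> stands for infinity.\<close>

definition tight_on :: "('k \<Rightarrow> 'a rel) \<Rightarrow> ('k \<Rightarrow> 'a option) \<Rightarrow> 'k set \<Rightarrow> ('k \<Rightarrow> 'a) \<Rightarrow> bool" where
  "tight_on r c A f \<longleftrightarrow> (\<forall>i. case c i of None \<Rightarrow> i \<notin> A
     | Some b \<Rightarrow> if i \<in> A then f i = b else f i \<in> underS (r i) b)"

text \<open>
  A function \<open>f\<close> in the family \<open>R\<close> of functions of rank \<open>\<gamma>\<close> is approximated from above: given an
  upper bound \<open>c\<close>, attained exactly on \<open>A\<close>, a member \<open>g\<close> of \<open>R\<close> with the same \<open>A\<close> is chosen depending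
  only on \<open>c\<close> and \<open>A\<close>, and \<open>c\<close> is lowered to \<open>g\<close> wherever \<open>f \<le> g\<close>. If \<open>A\<close> were null at all stages,
  then almost every coordinate, where \<open>c\<close> cannot drop infinitely often, would have a stage with
  \<open>g < f\<close>. As \<open>g\<close> has rank \<open>\<gamma>\<close>, the rank of \<open>f\<close> on each of countably many sets that cover almost
  everything would exceed \<open>\<gamma>\<close>, hence so would the rank of \<open>f\<close>.
\<close>

lemma rank_level_decoding:
  fixes r :: "'k \<Rightarrow> 'a rel" and \<gamma> :: "'c rel"
  assumes D: "aleph1_complete D" "D \<noteq> bot" and r: "\<And>i. Well_order (r i)"
  obtains d :: "('k set \<times> 'k set) list \<times> 'k set \<Rightarrow> 'k \<Rightarrow> 'a" where
    "\<forall>f \<in> ord_prod r. rank_elem D r f =o \<gamma> \<longrightarrow>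
      (\<exists>l A. A \<in> positive_sets D \<and> d (l, A) \<in> ord_prod r \<and> rank_elem D r (d (l, A)) =o \<gamma> \<and>
        (\<forall>i\<in>A. d (l, A) i = f i))"
proof -
  define R where "R = {f \<in> ord_prod r. rank_elem D r f =o \<gamma>}"
  define ch where "ch c A = (SOME g. g \<in> R \<and> tight_on r c A g)" for c A
  have ch: "ch c A \<in> R \<and> tight_on r c A (ch c A)" if "f \<in> R" "tight_on r c A f" for f c A
    unfolding ch_def by (rule someI[of _ f]) (use that in blast)
  show thesis
  proof (rule that[of "\<lambda>(l, A). ch (refine ch l) A"], intro ballI impI)
    fix f assume "f \<in> ord_prod r" "rank_elem D r f =o \<gamma>"
    then have f: "f \<in> R" and fF: "\<And>i. f i \<in> Field (r i)" by (auto simp: R_def ord_prod_def)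
    define A where "A l = {i. refine ch l i = Some (f i)}" for l
    define P where "P l = {i. (f i, ch (refine ch l) (A l) i) \<in> r i}" for l
    define L where "L n = ((\<lambda>l. (A l, P l) # l) ^^ n) []" for n
    define c where "c n = refine ch (L n)" for n
    define g where "g n = ch (c n) (A (L n))" for n
    have L_Suc: "L (Suc n) = (A (L n), P (L n)) # L n" for n by (simp add: L_def)
    have c_Suc: "c (Suc n) i = (if (f i, g n i) \<in> r i then Some (g n i) else c n i)" for n i
      by (simp add: c_def L_Suc g_def P_def)
    have above: "c n i = None \<or> (\<exists>b. c n i = Some b \<and> (f i, b) \<in> r i)" for n i
    proof (induction n)
      case 0
      then show ?case by (simp add: c_def L_def)
    qed (auto simp: c_Suc)
    have A: "A (L n) = {i. c n i = Some (f i)}" for n by (simp add: A_def c_def)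
    \<comment> \<open>\<open>f\<close> itself meets the requirement, so a choice exists at every
      stage.\<close>
    have "tight_on r (c n) (A (L n)) f" for n
      unfolding tight_on_def A
    proof (rule allI)
      fix i
      show "case c n i of None \<Rightarrow> i \<notin> {i. c n i = Some (f i)}
        | Some b \<Rightarrow> if i \<in> {i. c n i = Some (f i)} then f i = b else f i \<in> underS (r i) b"
        using above[of n i] Well_order_le_iff[OF r fF] by (auto split: option.split)
    qed
    then have g: "g n \<in> R" "tight_on r (c n) (A (L n)) (g n)" for n
      using ch[OF f] by (auto simp: g_def)
    have gA: "g n i = f i" if "i \<in> A (L n)" for n i
      using g(2)[of n] that unfolding tight_on_def A by (auto split: option.splits)
    have "\<exists>n. A (L n) \<in> positive_sets D"
    proof (rule ccontr)
      assume "\<nexists>n. A (L n) \<in> positive_sets D"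
      then have "\<forall>n. eventually (\<lambda>i. i \<notin> A (L n)) D" by (simp add: positive_sets_def)
      then have "eventually (\<lambda>i. \<forall>n. i \<notin> A (L n)) D"
        using D(1) unfolding aleph1_complete_def by fast
      then have "eventually (\<lambda>i. \<exists>n. i \<in> {i. (f i, g n i) \<notin> r i}) D"
      proof eventually_elim
        case (elim i)
        show ?case
        proof (rule ccontr)
          assume "\<not> ?thesis"
          \<comment> \<open>The bound at \<open>i\<close> is lowered at every stage but never
            attained by \<open>f\<close>, so tightness makes each choice strictly smaller at
            \<open>i\<close> than the previous one: an infinite descent.\<close>
          then have "c (Suc n) i = Some (g n i)" for n by (simp add: c_Suc)
          then have "g (Suc n) i \<in> underS (r i) (g n i)" for n
            using g(2)[of "Suc n", unfolded tight_on_def, rule_format, of i] elim by simp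
          then have "\<forall>n. (g (Suc n) i, g n i) \<in> r i - Id" by (simp add: underS_def)
          moreover have "wf (r i - Id)" using r by (simp add: well_order_on_def)
          ultimately show False
            by (auto simp: wf_iff_no_infinite_down_chain dest: spec[of _ "\<lambda>n. g n i"])
        qed
      qed
      then have "rank_elem D r f <o rank_elem D r f"
        unfolding rank_elem_def
      proof (rule rank_greater_if_countable_cover[OF D])
        fix n assume pos: "{i. (f i, g n i) \<notin> r i} \<in> positive_sets D"
        let ?E = "filter_plus D {i. (f i, g n i) \<notin> r i}"
        have E: "aleph1_complete ?E" "?E \<noteq> bot"
          using aleph1_complete_filter_plus[OF D(1)] pos filter_plus_neq_bot_iff by blast+
        have gF: "g n i \<in> Field (r i)" for i using g(1)[of n] by (simp add: R_def ord_prod_def)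
        \<comment> \<open>Both functions have rank \<open>\<gamma>\<close> for \<open>D\<close>, but
          on this positive set \<open>g n\<close> is strictly below \<open>f\<close>.\<close>
        have "rank_elem D r f =o rank_elem D r (g n)"
          using f g(1)[of n] ordIso_symmetric ordIso_transitive unfolding R_def by blast
        also have "rank_elem D r (g n) \<le>o rank_elem ?E r (g n)"
          unfolding rank_elem_def by (rule rank_finer_filter[OF D(1) E filter_plus_le])
        also have "rank_elem ?E r (g n) <o rank_elem ?E r f"
          by (rule rank_elem_less[OF E r])
            (simp add: eventually_filter_plus not_le_iff_underS[OF r fF gF])
        finally show "rank D (\<lambda>i. seg (r i) (f i)) <o rank ?E (\<lambda>i. seg (r i) (f i))"
          by (simp add: rank_elem_def)
      qed
      then show False using ordLess_irreflexive by blast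
    qed
    then obtain n where n: "A (L n) \<in> positive_sets D" ..
    have "(case (L n, A (L n)) of (l, A) \<Rightarrow> ch (refine ch l) A) = g n"
      by (simp add: g_def c_def)
    then show "\<exists>l A. A \<in> positive_sets D \<and> (case (l, A) of (l, A) \<Rightarrow> ch (refine ch l) A) \<in> ord_prod r
        \<and> rank_elem D r (case (l, A) of (l, A) \<Rightarrow> ch (refine ch l) A) =o \<gamma> \<and>
        (\<forall>i\<in>A. (case (l, A) of (l, A) \<Rightarrow> ch (refine ch l) A) i = f i)"
      using n g(1)[of n] gA unfolding R_def by (metis (no_types, lifting) mem_Collect_eq)
  qed
qed

text \<open>Lists are counted by length. This bounds the number of histories that serve as
  labels.\<close>

lemma card_of_lists_infinite:
  assumes "infinite (UNIV :: 'b set)"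
  shows "|UNIV :: 'b list set| \<le>o |UNIV :: 'b set|"
proof -
  have "|{l :: 'b list. length l = n}| \<le>o |UNIV :: 'b set|" for n
  proof (induction n)
    case 0
    have "{l :: 'b list. length l = 0} = {[]}" by auto
    then show ?case using assms card_of_singl_ordLeq[of "UNIV :: 'b set"] by auto
  next
    case (Suc n)
    have "{l :: 'b list. length l = Suc n} = (\<lambda>(x, l). x # l) ` (UNIV \<times> {l. length l = n})"
      by (force simp: length_Suc_conv)
    then have "|{l :: 'b list. length l = Suc n}| \<le>o |(UNIV :: 'b set) \<times> {l :: 'b list. length l = n}|"
      by (simp only: card_of_image)
    also have "|(UNIV :: 'b set) \<times> {l :: 'b list. length l = n}| \<le>o |UNIV :: 'b set|"
      using assms Suc
      by (intro card_of_Times_ordLeq_infinite_Field)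
        (simp_all only: Field_card_of card_of_Card_order card_of_card_order_on card_of_mono1[OF subset_refl] not_False_eq_True)
    finally show ?case .
  qed
  moreover have "|UNIV :: nat set| \<le>o |UNIV :: 'b set|"
    using assms infinite_iff_card_of_nat by blast
  ultimately have "|\<Union>n. {l :: 'b list. length l = n}| \<le>o |UNIV :: 'b set|"
    using assms by (intro card_of_UNION_ordLeq_infinite) auto
  moreover have "(\<Union>n. {l :: 'b list. length l = n}) = UNIV" by blast
  ultimately show ?thesis by simp
qed

section \<open>The rank of a product of regular cardinals\<close>

text \<open>For each positive \<open>A\<close>, the rank of \<open>\<delta>\<close> modulo
  \<open>filter_plus D A\<close> lies below \<open>rank D r\<close>, hence is reached by the
  \<open>D\<close>-rank of some \<open>G A\<close>. By regularity a single \<open>g\<close> bounds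
  all of these at most \<open>2^\<kappa>\<close> functions. If \<open>f\<close> were at most
  \<open>\<delta>\<close> on a positive \<open>A\<close>, its rank could not exceed that of
  \<open>G A\<close>, nor that of \<open>g\<close>.\<close>

lemma rank_elem_dominates:
  fixes r :: "'k \<Rightarrow> 'a rel"
  assumes D: "aleph1_complete D" "D \<noteq> bot"
    and r: "\<And>i. Card_order (r i) \<and> infinite (Field (r i)) \<and> regularCard (r i)"
    and card: "\<And>i. |UNIV :: 'k set set| <o r i"
    and rank: "\<And>A. A \<in> positive_sets D \<Longrightarrow> rank (filter_plus D A) r \<le>o rank D r"
    and \<delta>: "\<delta> \<in> ord_prod r"
  obtains g where "g \<in> ord_prod r"
    "\<And>f. f \<in> ord_prod r \<Longrightarrow> rank_elem D r g <o rank_elem D r f \<Longrightarrow>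
      eventually (\<lambda>i. \<delta> i \<in> underS (r i) (f i)) D"
proof -
  have wo: "Well_order (r i)" for i using r by (simp add: card_order_on_def)
  note DA = aleph1_complete_filter_plus[OF D(1)]
  have ne: "Field (r i) \<noteq> {}" for i using r infinite_imp_nonempty by blast
  have "\<exists>g. g \<in> ord_prod r \<and> (A \<in> positive_sets D \<longrightarrow>
      rank_elem (filter_plus D A) r \<delta> \<le>o rank_elem D r g)" for A
  proof (cases "A \<in> positive_sets D")
    case True
    then have A: "filter_plus D A \<noteq> bot" by (simp add: filter_plus_neq_bot_iff)
    have "rank_elem (filter_plus D A) r \<delta> <o rank D r"
      using rank_elem_less_rank[OF DA A wo \<delta>] rank[OF True] by (rule ordLess_ordLeq_trans)
    then obtain g where "g \<in> ord_prod r" "rank_elem (filter_plus D A) r \<delta> \<le>o rank_elem D r g"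
      by (rule rank_hit_elem[OF D wo ne])
    then show ?thesis by blast
  qed (use \<delta> in blast)
  then obtain G where G: "\<And>A. G A \<in> ord_prod r"
      "\<And>A. A \<in> positive_sets D \<Longrightarrow> rank_elem (filter_plus D A) r \<delta> \<le>o rank_elem D r (G A)"
    by metis
  have GF: "G A i \<in> Field (r i)" for A i using G(1)[of A] by (simp add: ord_prod_def)
  have "\<exists>b. b \<in> Field (r i) \<and> (\<forall>A. (G A i, b) \<in> r i)" for i
  proof -
    have "|range (\<lambda>A. G A i)| <o r i"
      using card_of_image card[of i] by (rule ordLeq_ordLess_trans)
    moreover have "range (\<lambda>A. G A i) \<subseteq> Field (r i)" using GF by blast
    ultimately have "\<not> cofinal (range (\<lambda>A. G A i)) (r i)"
      using r[of i] not_ordLess_ordIso unfolding regularCard_def by blast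
    then obtain b where b: "b \<in> Field (r i)" "\<And>A. b = G A i \<or> (b, G A i) \<notin> r i"
      unfolding cofinal_def by auto
    have "(G A i, b) \<in> r i" for A
    proof (cases "b = G A i")
      case True
      then show ?thesis using Well_order_le_iff[OF wo b(1)] by auto
    next
      case False
      then have "G A i \<in> underS (r i) b" using b(2)[of A] not_le_iff_underS[OF wo b(1) GF] by blast
      then show ?thesis by (simp add: underS_def)
    qed
    with b(1) show ?thesis by blast
  qed
  then obtain g where g: "\<And>i. g i \<in> Field (r i)" "\<And>i A. (G A i, g i) \<in> r i" by metis
  show thesis
  proof (rule that[of g])
    show "g \<in> ord_prod r" using g(1) by (simp add: ord_prod_def)
    fix f assume f: "f \<in> ord_prod r" and less: "rank_elem D r g <o rank_elem D r f"
    define A where "A = {i. (f i, \<delta> i) \<in> r i}"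
    have fF: "f i \<in> Field (r i)" and dF: "\<delta> i \<in> Field (r i)" for i
      using f \<delta> by (auto simp: ord_prod_def)
    have "A \<notin> positive_sets D"
    proof
      assume pos: "A \<in> positive_sets D"
      then have A: "filter_plus D A \<noteq> bot" by (simp add: filter_plus_neq_bot_iff)
      have "rank_elem D r f \<le>o rank_elem (filter_plus D A) r f"
        unfolding rank_elem_def by (rule rank_finer_filter[OF D(1) DA A filter_plus_le])
      also have "rank_elem (filter_plus D A) r f \<le>o rank_elem (filter_plus D A) r \<delta>"
        by (rule rank_elem_mono[OF DA A wo]) (simp add: eventually_filter_plus A_def)
      also have "rank_elem (filter_plus D A) r \<delta> \<le>o rank_elem D r (G A)" using G(2)[OF pos] .
      also have "rank_elem D r (G A) \<le>o rank_elem D r g"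
        by (rule rank_elem_mono[OF D wo]) (simp add: g(2))
      finally show False using less not_ordLeq_ordLess by blast
    qed
    then have "eventually (\<lambda>i. i \<notin> A) D" by (simp add: positive_sets_def)
    then show "eventually (\<lambda>i. \<delta> i \<in> underS (r i) (f i)) D"
      by eventually_elim (simp add: A_def not_le_iff_underS[OF wo fF dF])
  qed
qed

text \<open>Each regular \<open>r i\<close> absorbs the small factor \<open>w\<close> through a
  strictly increasing map \<open>h i\<close>. Applying these maps coordinatewise, with one label for
  all \<open>i\<close>, transfers the absorption to the rank.\<close>

lemma lex_ord_ordIso_rank:
  fixes r :: "'k \<Rightarrow> 'a rel" and lam :: "'b rel" and w :: "'w rel"
  assumes D: "aleph1_complete D" "D \<noteq> bot"
    and r: "\<And>i. Card_order (r i) \<and> infinite (Field (r i)) \<and> regularCard (r i)"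
    and w: "Well_order w" "Field w \<noteq> {}" "\<And>i. |Field w| <o r i"
    and lam: "lam =o rank D r"
  shows "lex_ord lam w =o lam"
proof -
  have wr: "Well_order (r i)" for i using r by (simp add: card_order_on_def)
  have wl: "Well_order lam" using lam by (auto simp: ordIso_def)
  have ne: "Field (r i) \<noteq> {}" for i using r infinite_imp_nonempty by blast
  note L = Field_lex_ord[OF wl w(1)] underS_lex_ord[OF wl w(1)]
  note Li = Field_lex_ord[OF wr w(1)] underS_lex_ord[OF wr w(1)]
  have "\<exists>h. (\<forall>p \<in> Field (lex_ord (r i) w). h p \<in> Field (r i)) \<and>
      (\<forall>p q. q \<in> underS (lex_ord (r i) w) p \<longrightarrow> h q \<in> underS (r i) (h p))" for i
  proof -
    have "lex_ord (r i) w \<le>o r i" using r[of i] w by (intro lex_ord_le_Card_order) auto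
    then show ?thesis by (rule ordLeq_strict_monoE) blast
  qed
  then obtain h where hF: "\<And>i p. p \<in> Field (lex_ord (r i) w) \<Longrightarrow> h i p \<in> Field (r i)"
      and h: "\<And>i p q. q \<in> underS (lex_ord (r i) w) p \<Longrightarrow> h i q \<in> underS (r i) (h i p)"
    by metis
  have "lex_ord lam w \<le>o lam"
  \<comment> \<open>A pair may have many representatives, since \<open>f\<close> is only required to
    have at least the rank given by the first coordinate.\<close>
  proof (rule ordLeq_by_representatives[where v = "rank_elem D r" and
        Q = "\<lambda>p x. \<exists>f \<in> ord_prod r. p \<in> Field (lex_ord lam w) \<and> seg lam (fst p) \<le>o rank_elem D r f \<and>
          x = (\<lambda>i. h i (f i, snd p))"])
    show "Well_order (lex_ord lam w)" by (rule Well_order_lex_ord[OF wl w(1)])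
    show "Well_order lam" by (rule wl)
  next
    fix p assume p: "p \<in> Field (lex_ord lam w)"
    then have "fst p \<in> Field lam" by (auto simp: L)
    then have "seg lam (fst p) <o rank D r"
      using seg_ordLess[OF wl] lam ordLess_ordIso_trans by blast
    then obtain f where "f \<in> ord_prod r" "seg lam (fst p) \<le>o rank_elem D r f"
      by (rule rank_hit_elem[OF D wr ne])
    with p show "\<exists>x. \<exists>f \<in> ord_prod r. p \<in> Field (lex_ord lam w) \<and>
        seg lam (fst p) \<le>o rank_elem D r f \<and> x = (\<lambda>i. h i (f i, snd p))" by blast
  next
    fix p x
    assume "\<exists>f \<in> ord_prod r. p \<in> Field (lex_ord lam w) \<and> seg lam (fst p) \<le>o rank_elem D r f \<and>
      x = (\<lambda>i. h i (f i, snd p))"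
    then have "x \<in> ord_prod r" by (auto simp: ord_prod_def L Li intro!: hF)
    then have "rank_elem D r x <o rank D r" by (rule rank_elem_less_rank[OF D wr])
    then show "rank_elem D r x <o lam" using lam ordIso_symmetric ordLess_ordIso_trans by blast
  next
    fix p x q
    assume "\<exists>f \<in> ord_prod r. p \<in> Field (lex_ord lam w) \<and> seg lam (fst p) \<le>o rank_elem D r f \<and>
      x = (\<lambda>i. h i (f i, snd p))" and q: "q \<in> underS (lex_ord lam w) p"
    then obtain f where f: "f \<in> ord_prod r" "p \<in> Field (lex_ord lam w)"
      "seg lam (fst p) \<le>o rank_elem D r f" "x = (\<lambda>i. h i (f i, snd p))" by blast
    have qF: "q \<in> Field (lex_ord lam w)" using underS_imp_Field(1)[OF q] .
    obtain a s b t where ab: "q = (a, s)" "p = (b, t)" by (cases p, cases q)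
    have st: "s \<in> Field w" "t \<in> Field w" using qF f(2) by (auto simp: ab L)
    \<comment> \<open>If the first coordinate drops, a smaller function of sufficient rank exists;
      if only the label drops, \<open>f\<close> is kept.\<close>
    have "\<exists>g \<in> ord_prod r. seg lam a \<le>o rank_elem D r g \<and>
        eventually (\<lambda>i. (g i, s) \<in> underS (lex_ord (r i) w) (f i, t)) D"
      using q unfolding ab L
    proof (elim disjE conjE)
      assume "a \<in> underS lam b"
      then have "seg lam a <o rank_elem D r f"
        using seg_mono[OF wl] f(3) ordLess_ordLeq_trans unfolding ab by fastforce
      then obtain g where g: "g \<in> ord_prod r" "eventually (\<lambda>i. g i \<in> underS (r i) (f i)) D"
        "seg lam a \<le>o rank_elem D r g"
        by (rule rank_elem_hit[OF D wr f(1)])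
      from g(2) have "eventually (\<lambda>i. (g i, s) \<in> underS (lex_ord (r i) w) (f i, t)) D"
        by eventually_elim (simp add: Li st)
      with g show ?thesis by blast
    next
      assume "a = b" "s \<in> underS w t"
      with f(1,3) show ?thesis by (intro bexI[of _ f]) (auto simp: ab Li ord_prod_def)
    qed
    then obtain g where g: "g \<in> ord_prod r" "seg lam a \<le>o rank_elem D r g"
      "eventually (\<lambda>i. (g i, s) \<in> underS (lex_ord (r i) w) (f i, t)) D" by blast
    have "rank_elem D r (\<lambda>i. h i (g i, s)) <o rank_elem D r x"
      unfolding f(4)
      by (rule rank_elem_less[OF D wr], use g(3) in eventually_elim) (simp add: ab h)
    with g(1,2) qF show "\<exists>y. (\<exists>f \<in> ord_prod r. q \<in> Field (lex_ord lam w) \<and>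
        seg lam (fst q) \<le>o rank_elem D r f \<and> y = (\<lambda>i. h i (f i, snd q))) \<and>
        rank_elem D r y <o rank_elem D r x"
      by (auto simp: ab)
  qed
  moreover have "lam \<le>o lex_ord lam w"
  proof -
    obtain s where "s \<in> Field w" using w(2) by blast
    then show ?thesis
      by (intro ordLeq_if_strict_mono[OF wl Well_order_lex_ord[OF wl w(1)], of "\<lambda>a. (a, s)"])
        (auto simp: L)
  qed
  ultimately show ?thesis by (simp add: ordIso_iff_ordLeq)
qed

section \<open>Sequences of unbounded sets and increasing sequences\<close>

text \<open>\<open>\<nu>\<close> may live on another type, whereas minimality of \<open>r\<close>
  concerns relations on its own type; a segment of \<open>r\<close> mediates.\<close>

lemma is_least_ordinal_below:
  assumes "is_least_ordinal P r" "\<nu> <o r"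
  obtains s where "\<nu> =o s" "\<not> P s"
proof -
  obtain a where "a \<in> Field r" "\<nu> =o seg r a" using assms(2) by (rule ordLess_segE)
  with assms(1) that show thesis
    by (auto simp: is_least_ordinal_def intro: seg_ordLess)
qed

lemma cofinal_iff_underS: "cofinal A r \<longleftrightarrow> (\<forall>a \<in> Field r. \<exists>b \<in> A. a \<in> underS r b)"
  by (auto simp: cofinal_def underS_def)

lemma is_dp3_sequence_reindex:
  assumes "is_dp3_sequence \<chi> \<nu> A" "\<nu>' \<le>o \<nu>"
  shows "\<exists>A'. is_dp3_sequence \<chi> \<nu>' A'"
proof -
  obtain h where h: "\<And>a. a \<in> Field \<nu>' \<Longrightarrow> h a \<in> Field \<nu>"
    "\<And>a b. b \<in> underS \<nu>' a \<Longrightarrow> h b \<in> underS \<nu> (h a)"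
    using assms(2) by (rule ordLeq_strict_monoE) blast
  have "is_dp3_sequence \<chi> \<nu>' (A \<circ> h)"
    using assms(1) h unfolding is_dp3_sequence_def underS_def by simp
  then show ?thesis by blast
qed

lemma is_increasing_sequence_reindex:
  assumes "is_increasing_sequence D m \<nu> F" "\<nu>' \<le>o \<nu>"
  shows "\<exists>F'. is_increasing_sequence D m \<nu>' F'"
proof -
  obtain h where h: "\<And>a. a \<in> Field \<nu>' \<Longrightarrow> h a \<in> Field \<nu>"
    "\<And>a b. b \<in> underS \<nu>' a \<Longrightarrow> h b \<in> underS \<nu> (h a)"
    using assms(2) by (rule ordLeq_strict_monoE) blast
  have "is_increasing_sequence D m \<nu>' (F \<circ> h)"
    using assms(1) h unfolding is_increasing_sequence_def underS_def by simp
  then show ?thesis by blast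
qed

lemma is_dp3_sequence_ordIso:
  assumes A: "is_dp3_sequence \<chi> \<nu> A" and iso: "\<chi> =o \<chi>'"
  shows "\<exists>A'. is_dp3_sequence \<chi>' \<nu> A'"
proof -
  obtain h where im: "h ` Field \<chi> = Field \<chi>'" and inj: "inj_on h (Field \<chi>)"
    and h: "\<And>a b. a \<in> Field \<chi> \<Longrightarrow> b \<in> Field \<chi> \<Longrightarrow> h b \<in> underS \<chi>' (h a) \<longleftrightarrow> b \<in> underS \<chi> a"
    using iso by (rule ordIso_strict_monoE) blast
  have cof: "cofinal (h ` X) \<chi>' \<longleftrightarrow> cofinal X \<chi>" if "X \<subseteq> Field \<chi>" for X
    unfolding cofinal_iff_underS im[symmetric] using that h by (auto simp: subset_iff)
  have diff: "h ` (X - Y) = h ` X - h ` Y" if "X \<subseteq> Field \<chi>" "Y \<subseteq> Field \<chi>" for X Y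
    using inj that by (intro inj_on_image_set_diff) auto
  have sub: "A \<alpha> \<subseteq> Field \<chi>" if "\<alpha> \<in> Field \<nu>" for \<alpha>
    using A that by (simp add: is_dp3_sequence_def)
  have "is_dp3_sequence \<chi>' \<nu> (\<lambda>\<alpha>. h ` A \<alpha>)"
    unfolding is_dp3_sequence_def
  proof (intro conjI ballI allI impI)
    fix \<alpha> assume \<alpha>: "\<alpha> \<in> Field \<nu>"
    show "h ` A \<alpha> \<subseteq> Field \<chi>'" using sub[OF \<alpha>] im by blast
    show "cofinal (h ` A \<alpha>) \<chi>'"
      using A \<alpha> cof[OF sub[OF \<alpha>]] by (simp add: is_dp3_sequence_def)
  next
    fix \<alpha> \<beta> assume ab: "(\<alpha>, \<beta>) \<in> \<nu> \<and> \<alpha> \<noteq> \<beta>"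
    then have s: "A \<alpha> \<subseteq> Field \<chi>" "A \<beta> \<subseteq> Field \<chi>" using sub by (auto simp: Field_def)
    have d: "A \<beta> - A \<alpha> \<subseteq> Field \<chi>" "A \<alpha> - A \<beta> \<subseteq> Field \<chi>" using s by auto
    have "cofinal (A \<beta> - A \<alpha>) \<chi> \<and> \<not> cofinal (A \<alpha> - A \<beta>) \<chi>"
      using A ab by (simp add: is_dp3_sequence_def)
    then show "cofinal (h ` A \<beta> - h ` A \<alpha>) \<chi>'" "\<not> cofinal (h ` A \<alpha> - h ` A \<beta>) \<chi>'"
      using cof[OF d(1)] cof[OF d(2)] diff[OF s] diff[OF s(2,1)] by simp_all
  qed
  then show ?thesis by blast
qed

lemma less_dp3plusD:
  fixes \<chi> :: "'a rel"
  assumes "\<nu> <o dp3plus \<chi>"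
  shows "\<exists>A. is_dp3_sequence \<chi> \<nu> A"
proof -
  obtain s :: "'a set set rel" where s: "\<nu> =o s" "\<exists>A. is_dp3_sequence \<chi> s A"
    using is_least_ordinal_below[OF dp3plus_spec assms] by blast
  then show ?thesis using is_dp3_sequence_reindex ordIso_imp_ordLeq[OF s(1)] by blast
qed

lemma less_dp3plusI:
  assumes "Well_order \<nu>" "is_dp3_sequence \<chi> \<nu> A"
  shows "\<nu> <o dp3plus \<chi>"
proof (rule ccontr)
  note spec = dp3plus_spec[of \<chi>, unfolded is_least_ordinal_def]
  assume "\<not> ?thesis"
  then have "dp3plus \<chi> \<le>o \<nu>"
    using assms(1) spec by (simp add: not_ordLess_iff_ordLeq)
  then show False using is_dp3_sequence_reindex[OF assms(2)] spec by blast
qed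

lemma less_Depth_plusD:
  fixes D :: "'k filter" and m :: "'k \<Rightarrow> 'm rel"
  assumes "D \<noteq> bot" "\<nu> <o Depth_plus D m"
  shows "\<exists>F. is_increasing_sequence D m \<nu> F"
proof -
  obtain s :: "('k \<Rightarrow> 'm) set rel" where s: "\<nu> =o s" "\<exists>F. is_increasing_sequence D m s F"
    using is_least_ordinal_below[OF Depth_plus_spec[OF assms(1)] assms(2)] by blast
  then show ?thesis using is_increasing_sequence_reindex ordIso_imp_ordLeq[OF s(1)] by blast
qed

section \<open>Filters with an atom\<close>

lemma eventually_atom:
  assumes "{i} \<in> positive_sets D"
  shows "eventually P (filter_plus D {i}) \<longleftrightarrow> P i"
proof (cases "P i")
  case False
  then have "(\<lambda>j. j \<in> {i} \<longrightarrow> P j) = (\<lambda>j. j \<in> UNIV - {i})" by auto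
  with assms False show ?thesis by (simp add: eventually_filter_plus positive_sets_def)
qed (simp add: eventually_filter_plus)

text \<open>Modulo an atom, functions compare as their values at \<open>i\<close> do. One inequality
  is an induction; for the other, constant functions represent the elements of
  \<open>f i\<close>.\<close>

lemma rank_atom:
  fixes f :: "'k \<Rightarrow> 'a rel"
  assumes D: "aleph1_complete D" and i: "{i} \<in> positive_sets D" and f: "Well_order (f i)"
  shows "rank (filter_plus D {i}) f =o f i"
proof -
  let ?E = "filter_plus D {i}"
  have E: "aleph1_complete ?E" "?E \<noteq> bot"
    using aleph1_complete_filter_plus[OF D] i filter_plus_neq_bot_iff by blast+
  have fl: "fun_less ?E g h \<longleftrightarrow> g i <o h i" for g h :: "'k \<Rightarrow> 'a rel"
    by (simp add: fun_less_def eventually_atom[OF i])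
  have "rank ?E f \<le>o f i"
    using wf_fun_less[OF E] f
  proof (induction f rule: wf_induct_rule)
    case (less f)
    show ?case
    proof (rule ccontr)
      assume "\<not> ?thesis"
      then have "f i <o rank ?E f"
        using less.prems by (simp add: not_ordLeq_iff_ordLess Well_order_rank[OF E])
      then obtain g where g: "fun_less ?E g f" "f i \<le>o rank ?E g" by (rule rank_hit[OF E])
      then have l: "g i <o f i" by (simp add: fl)
      then have "rank ?E g \<le>o g i" using less.IH[of g] g(1) by (auto simp: ordLess_def)
      with g(2) l show False by (meson not_ordLeq_ordLess ordLeq_transitive)
    qed
  qed
  moreover have "f i \<le>o rank ?E f"
    by (rule ordLeq_by_representatives[OF f Well_order_rank[OF E],
          where v = "rank ?E" and Q = "\<lambda>a x. a \<in> Field (f i) \<and> x = (\<lambda>_. seg (f i) a)"])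
      (use f in \<open>auto intro!: rank_less[OF E] seg_ordLess simp: fl seg_mono underS_imp_Field\<close>)
  ultimately show ?thesis by (simp add: ordIso_iff_ordLeq)
qed

section \<open>The main construction\<close>

text \<open>
  With \<open>d c\<close> decoding the functions of rank \<open>c\<close>, the set \<open>B \<alpha>\<close> consists of the pairs \<open>(c, (l, A))\<close>
  such that \<open>d c (l, A)\<close> lies in the product of the sets \<open>S i (F \<alpha> i)\<close> almost everywhere on \<open>A\<close>.
\<close>

lemma ex_dp3_sequence_rank:
  fixes D :: "'k filter" and r :: "'k \<Rightarrow> 'a rel" and lam :: "'b rel"
    and m :: "'k \<Rightarrow> 'm rel" and \<mu> :: "'n rel"
  assumes inf: "infinite (UNIV :: 'k set)"
    and D: "aleph1_complete D" "D \<noteq> bot"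
    and r: "\<And>i. Card_order (r i) \<and> infinite (Field (r i)) \<and> regularCard (r i)"
    and card: "\<And>i. |UNIV :: 'k set set| <o r i"
    and lam: "\<And>A. A \<in> positive_sets D \<Longrightarrow> rank (filter_plus D A) r =o lam"
    and S: "\<And>i. is_dp3_sequence (r i) (m i) (S i)"
    and F: "is_increasing_sequence D m \<mu> F"
  shows "\<exists>B. is_dp3_sequence lam \<mu> B"
proof -
  \<comment> \<open>The labels are the codes read by the decoding functions; their number is
    \<open>2^\<kappa>\<close> because the index set is infinite.\<close>
  let ?w = "|UNIV :: (('k set \<times> 'k set) list \<times> 'k set) set|"
  have wr: "Well_order (r i)" for i using r by (simp add: card_order_on_def)
  have ne: "Field (r i) \<noteq> {}" for i using r infinite_imp_nonempty by blast
  have top: "UNIV \<in> positive_sets D" "filter_plus D UNIV = D"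
    using D(2) by (simp_all add: positive_sets_def filter_plus_def trivial_limit_def)
  have lamD: "lam =o rank D r" using lam[OF top(1)] top(2) ordIso_symmetric by metis
  then have wl: "Well_order lam" by (auto simp: ordIso_def)
  have le: "rank (filter_plus D A) r \<le>o rank D r" if "A \<in> positive_sets D" for A
    using ordIso_transitive[OF lam[OF that] lamD] by (rule ordIso_imp_ordLeq)
  have w: "Well_order ?w" "Field ?w = UNIV" by (rule card_of_Well_order) (rule Field_card_of)
  have wcard: "|Field ?w| <o r i" for i
  proof -
    let ?P = "UNIV :: 'k set set"
    have infP: "infinite ?P" using inf by (simp add: Finite_Set.finite_set)
    have infPP: "infinite (UNIV :: ('k set \<times> 'k set) set)"
      using infP by (simp add: finite_prod)
    have PP: "|UNIV :: ('k set \<times> 'k set) set| \<le>o |?P|"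
      using card_of_Times_same_infinite[OF infP] by (simp add: ordIso_imp_ordLeq)
    have lists: "|UNIV :: ('k set \<times> 'k set) list set| \<le>o |?P|"
      using card_of_lists_infinite[OF infPP] PP by (rule ordLeq_transitive)
    have "|(UNIV :: ('k set \<times> 'k set) list set) \<times> ?P| \<le>o |?P|"
      using infP lists
      by (intro card_of_Times_ordLeq_infinite_Field)
        (simp_all only: Field_card_of card_of_Card_order card_of_card_order_on
          card_of_mono1[OF subset_refl] not_False_eq_True)
    then have "|UNIV :: (('k set \<times> 'k set) list \<times> 'k set) set| \<le>o |?P|" by simp
    then show ?thesis unfolding w(2) using card[of i] by (rule ordLeq_ordLess_trans)
  qed
  define L where "L = lex_ord lam ?w"
  have FL: "Field L = Field lam \<times> UNIV"
    using Field_lex_ord[OF wl w(1)] w(2) by (simp add: L_def)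
  have UL: "(a, s) \<in> underS L (b, t)" if "a \<in> underS lam b" for a b s t
    using that underS_lex_ord[OF wl w(1)] w(2) by (simp add: L_def)
  have UL': "(a, b) \<in> lam" if "(a, s) \<in> underS L (b, t)" for a b s t
    using that underS_lex_ord[OF wl w(1)] Well_order_le_iff[OF wl] underS_imp_Field(1)[of a lam b]
    unfolding L_def by blast
  have Liso: "L =o lam"
    unfolding L_def using r wcard w lamD by (intro lex_ord_ordIso_rank[OF D]) auto
  have ex_seg: "\<exists>c \<in> Field lam. rank_elem D r f =o seg lam c" if "f \<in> ord_prod r" for f
  proof -
    have "rank_elem D r f <o lam"
      using rank_elem_less_rank[OF D wr that] lamD ordIso_symmetric ordLess_ordIso_trans by blast
    then show ?thesis by (rule ordLess_segE) blast
  qed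
  have ex_above: "\<exists>f. f \<in> ord_prod r \<and> seg lam c \<le>o rank_elem D r f" if "c \<in> Field lam" for c
  proof -
    have "seg lam c <o rank D r" using seg_ordLess[OF wl that] lamD by (rule ordLess_ordIso_trans)
    then show ?thesis by (rule rank_hit_elem[OF D wr ne]) blast
  qed
  have "\<exists>d :: ('k set \<times> 'k set) list \<times> 'k set \<Rightarrow> 'k \<Rightarrow> 'a.
      \<forall>f \<in> ord_prod r. rank_elem D r f =o seg lam c \<longrightarrow>
      (\<exists>l A. A \<in> positive_sets D \<and> d (l, A) \<in> ord_prod r \<and> rank_elem D r (d (l, A)) =o seg lam c \<and>
        (\<forall>i\<in>A. d (l, A) i = f i))" for c
    by (rule rank_level_decoding[where r = r, OF D wr, where \<gamma> = "seg lam c"]) (rule exI)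
  then obtain d :: "'b \<Rightarrow> ('k set \<times> 'k set) list \<times> 'k set \<Rightarrow> 'k \<Rightarrow> 'a" where d: "\<And>c f. f \<in> ord_prod r \<Longrightarrow> rank_elem D r f =o seg lam c \<Longrightarrow>
      \<exists>l A. A \<in> positive_sets D \<and> d c (l, A) \<in> ord_prod r \<and> rank_elem D r (d c (l, A)) =o seg lam c \<and>
        (\<forall>i\<in>A. d c (l, A) i = f i)"
    by metis
  \<comment> \<open>Only codes that decode to a function of rank \<open>c\<close> are kept, so the
    first coordinate measures the rank.\<close>
  define V where "V = {(c, (l, A)). c \<in> Field lam \<and> A \<in> positive_sets D \<and>
    d c (l, A) \<in> ord_prod r \<and> rank_elem D r (d c (l, A)) =o seg lam c}"
  define B where "B \<alpha> = {(c, (l, A)) \<in> V. eventually (\<lambda>i. d c (l, A) i \<in> S i (F \<alpha> i)) (filter_plus D A)}" for \<alpha>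
  \<comment> \<open>\<open>Y\<close> is general because this serves for the sets
    \<open>S i (F \<alpha> i)\<close>, for their differences and for the whole fields. The decoded
    function agrees with the constructed \<open>f\<close> only on \<open>A\<close>, hence the filter
    in the conclusion.\<close>
  have unbounded: "\<exists>c l A. c0 \<in> underS lam c \<and> (c, (l, A)) \<in> V \<and>
      eventually (\<lambda>i. d c (l, A) i \<in> Y i) (filter_plus D A)"
    if Y: "eventually (\<lambda>i. Y i \<subseteq> Field (r i) \<and> cofinal (Y i) (r i)) D" and c0: "c0 \<in> Field lam" for Y c0
  proof -
    obtain g where g: "g \<in> ord_prod r" "seg lam c0 \<le>o rank_elem D r g" using ex_above[OF c0] by blast
    have gF: "g i \<in> Field (r i)" for i using g(1) by (simp add: ord_prod_def)
    have "\<exists>b \<in> Field (r i). Y i \<subseteq> Field (r i) \<and> cofinal (Y i) (r i) \<longrightarrow> b \<in> Y i \<and> g i \<in> underS (r i) b" for i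
      using gF[of i] unfolding cofinal_iff_underS by blast
    then obtain f where f: "\<And>i. f i \<in> Field (r i)"
      "\<And>i. Y i \<subseteq> Field (r i) \<and> cofinal (Y i) (r i) \<Longrightarrow> f i \<in> Y i \<and> g i \<in> underS (r i) (f i)"
      by metis
    have fP: "f \<in> ord_prod r" using f(1) by (simp add: ord_prod_def)
    have fY: "eventually (\<lambda>i. f i \<in> Y i) D" using Y by eventually_elim (use f(2) in blast)
    have "eventually (\<lambda>i. g i \<in> underS (r i) (f i)) D" using Y by eventually_elim (use f(2) in blast)
    then have gf: "rank_elem D r g <o rank_elem D r f" by (rule rank_elem_less[OF D wr])
    obtain c where c: "c \<in> Field lam" "rank_elem D r f =o seg lam c" using ex_seg[OF fP] by blast
    have "seg lam c0 <o seg lam c"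
      using ordLeq_ordLess_trans[OF g(2) gf] c(2) by (rule ordLess_ordIso_trans)
    then have cc: "c0 \<in> underS lam c" using seg_less_iff[OF wl c0 c(1)] by blast
    obtain l A where lA: "A \<in> positive_sets D" "d c (l, A) \<in> ord_prod r"
      "rank_elem D r (d c (l, A)) =o seg lam c" "\<forall>i\<in>A. d c (l, A) i = f i"
      using d[OF fP c(2)] by blast
    have "eventually (\<lambda>i. d c (l, A) i \<in> Y i) (filter_plus D A)"
      using fY unfolding eventually_filter_plus by eventually_elim (use lA(4) in simp)
    with lA(1-3) c(1) cc show ?thesis unfolding V_def by blast
  qed
  have cofinalI: "cofinal X L"
    if X: "\<And>c0. c0 \<in> Field lam \<Longrightarrow> \<exists>c l A. c0 \<in> underS lam c \<and> (c, (l, A)) \<in> X" for X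
    unfolding cofinal_iff_underS
  proof
    fix p assume "p \<in> Field L"
    then have "fst p \<in> Field lam" by (auto simp: FL)
    then obtain c l A where "fst p \<in> underS lam c" "(c, (l, A)) \<in> X" using X by blast
    then show "\<exists>b\<in>X. p \<in> underS L b"
      using UL[of "fst p" c "snd p" "(l, A)"] by auto
  qed
  have SF: "S i a \<subseteq> Field (r i)" "cofinal (S i a) (r i)" if "a \<in> Field (m i)" for i a
    using S[of i] that by (auto simp: is_dp3_sequence_def)
  have FF: "F \<alpha> i \<in> Field (m i)" if "\<alpha> \<in> Field \<mu>" for \<alpha> i
    using F that by (auto simp: is_increasing_sequence_def ord_prod_def)
  have "is_dp3_sequence L \<mu> B"
    unfolding is_dp3_sequence_def
  proof (intro conjI ballI allI impI)
    fix \<alpha> assume \<alpha>: "\<alpha> \<in> Field \<mu>"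
    show "B \<alpha> \<subseteq> Field L" by (auto simp: B_def V_def FL)
    show "cofinal (B \<alpha>) L"
    proof (rule cofinalI)
      fix c0 assume "c0 \<in> Field lam"
      then show "\<exists>c l A. c0 \<in> underS lam c \<and> (c, (l, A)) \<in> B \<alpha>"
        using unbounded[of "\<lambda>i. S i (F \<alpha> i)" c0] SF FF[OF \<alpha>] unfolding B_def by simp
    qed
  next
    fix \<alpha> \<beta> assume ab: "(\<alpha>, \<beta>) \<in> \<mu> \<and> \<alpha> \<noteq> \<beta>"
    then have abF: "\<alpha> \<in> Field \<mu>" "\<beta> \<in> Field \<mu>" by (auto simp: Field_def)
    have less: "eventually (\<lambda>i. (F \<alpha> i, F \<beta> i) \<in> m i \<and> F \<alpha> i \<noteq> F \<beta> i) D"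
      using F ab by (auto simp: is_increasing_sequence_def prod_less_def)
    have diff: "eventually (\<lambda>i. cofinal (S i (F \<beta> i) - S i (F \<alpha> i)) (r i) \<and>
        \<not> cofinal (S i (F \<alpha> i) - S i (F \<beta> i)) (r i)) D"
      using less by eventually_elim (use S in \<open>auto simp: is_dp3_sequence_def\<close>)
    show "cofinal (B \<beta> - B \<alpha>) L"
    proof (rule cofinalI)
      fix c0 assume c0: "c0 \<in> Field lam"
      let ?Y = "\<lambda>i. S i (F \<beta> i) - S i (F \<alpha> i)"
      have "eventually (\<lambda>i. ?Y i \<subseteq> Field (r i) \<and> cofinal (?Y i) (r i)) D"
        using diff by eventually_elim (use SF FF[OF abF(2)] in blast)
      then obtain c l A where c: "c0 \<in> underS lam c" "(c, (l, A)) \<in> V"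
        and dY: "eventually (\<lambda>i. d c (l, A) i \<in> ?Y i) (filter_plus D A)"
        using unbounded[where Y = ?Y, OF _ c0] by blast
      have nb: "filter_plus D A \<noteq> bot" using c(2) by (simp add: V_def filter_plus_neq_bot_iff)
      \<comment> \<open>Membership in \<open>B \<alpha>\<close> is tested on the positive set
        \<open>A\<close> itself, where the decoded function almost everywhere avoids
        \<open>S i (F \<alpha> i)\<close>.\<close>
      have "\<not> eventually (\<lambda>i. d c (l, A) i \<in> S i (F \<alpha> i)) (filter_plus D A)"
      proof
        assume "eventually (\<lambda>i. d c (l, A) i \<in> S i (F \<alpha> i)) (filter_plus D A)"
        with dY have "eventually (\<lambda>i. False) (filter_plus D A)" by eventually_elim simp
        with nb show False by (simp add: trivial_limit_def)
      qed
      moreover have "eventually (\<lambda>i. d c (l, A) i \<in> S i (F \<beta> i)) (filter_plus D A)"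
        using dY by eventually_elim simp
      ultimately have "(c, (l, A)) \<in> B \<beta> - B \<alpha>" using c(2) by (simp add: B_def)
      with c(1) show "\<exists>c l A. c0 \<in> underS lam c \<and> (c, (l, A)) \<in> B \<beta> - B \<alpha>" by blast
    qed
    \<comment> \<open>\<open>\<delta> i\<close> bounds the difference if it is bounded, and is an
      arbitrary element otherwise.\<close>
    have "\<exists>b \<in> Field (r i). \<not> cofinal (S i (F \<alpha> i) - S i (F \<beta> i)) (r i) \<longrightarrow>
        (\<forall>x \<in> S i (F \<alpha> i) - S i (F \<beta> i). b \<notin> underS (r i) x)" for i
      using ne[of i] unfolding cofinal_iff_underS by blast
    then obtain \<delta> where \<delta>: "\<And>i. \<delta> i \<in> Field (r i)"
      "\<And>i x. \<not> cofinal (S i (F \<alpha> i) - S i (F \<beta> i)) (r i) \<Longrightarrow>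
        x \<in> S i (F \<alpha> i) - S i (F \<beta> i) \<Longrightarrow> \<delta> i \<notin> underS (r i) x"
      by metis
    have "\<delta> \<in> ord_prod r" using \<delta>(1) by (simp add: ord_prod_def)
    then obtain g where g: "g \<in> ord_prod r"
      and dom: "\<And>f. f \<in> ord_prod r \<Longrightarrow> rank_elem D r g <o rank_elem D r f \<Longrightarrow>
        eventually (\<lambda>i. \<delta> i \<in> underS (r i) (f i)) D"
      using rank_elem_dominates[OF D r card le, where \<delta> = \<delta>] by blast
    obtain c1 where c1: "c1 \<in> Field lam" "rank_elem D r g =o seg lam c1" using ex_seg[OF g] by blast
    \<comment> \<open>A code with first coordinate above \<open>c1\<close> decodes to a function
      that exceeds \<open>\<delta>\<close> almost everywhere and so avoids the differences. Being in
      \<open>S i (F \<alpha> i)\<close> almost everywhere on \<open>A\<close>, it is then in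
      \<open>S i (F \<beta> i)\<close> too.\<close>
    have below: "(c, c1) \<in> lam" if "(c, (l, A)) \<in> B \<alpha> - B \<beta>" for c l A
    proof (rule ccontr)
      assume "(c, c1) \<notin> lam"
      have cV: "c \<in> Field lam" "d c (l, A) \<in> ord_prod r" "rank_elem D r (d c (l, A)) =o seg lam c"
        and in\<alpha>: "eventually (\<lambda>i. d c (l, A) i \<in> S i (F \<alpha> i)) (filter_plus D A)"
        and notin\<beta>: "\<not> eventually (\<lambda>i. d c (l, A) i \<in> S i (F \<beta> i)) (filter_plus D A)"
        using that by (auto simp: B_def V_def)
      have "seg lam c1 <o seg lam c"
        using \<open>(c, c1) \<notin> lam\<close> not_le_iff_underS[OF wl cV(1) c1(1)] seg_mono[OF wl] by blast
      then have "rank_elem D r g <o rank_elem D r (d c (l, A))"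
        using c1(2) cV(3) by (meson ordIso_ordLess_trans ordIso_symmetric ordLess_ordIso_trans)
      then have "eventually (\<lambda>i. \<delta> i \<in> underS (r i) (d c (l, A) i)) D" by (rule dom[OF cV(2)])
      with diff have "eventually (\<lambda>i. d c (l, A) i \<notin> S i (F \<alpha> i) - S i (F \<beta> i)) D"
        by eventually_elim (use \<delta>(2) in blast)
      then have "eventually (\<lambda>i. d c (l, A) i \<notin> S i (F \<alpha> i) - S i (F \<beta> i)) (filter_plus D A)"
        using filter_plus_le[of D A] by (simp add: le_filter_def)
      with in\<alpha> have "eventually (\<lambda>i. d c (l, A) i \<in> S i (F \<beta> i)) (filter_plus D A)"
        by eventually_elim blast
      with notin\<beta> show False by blast
    qed
    \<comment> \<open>Applied to the whole fields, \<open>unbounded\<close> shows that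
      \<open>lam\<close> has an element \<open>c2\<close> above \<open>c1\<close>.\<close>
    have "cofinal (Field (r i)) (r i)" for i
      unfolding cofinal_def using infinite_Card_order_limit[of "r i"] r[of i] by blast
    then obtain c2 where c2: "c1 \<in> underS lam c2"
      using unbounded[of "\<lambda>i. Field (r i)" c1] c1(1) by auto
    \<comment> \<open>A pair above \<open>(c2, ([], {}))\<close> may still have first coordinate
      \<open>c2\<close>, which is why \<open>c2\<close> lies strictly above \<open>c1\<close>. The
      label is arbitrary.\<close>
    have "x \<notin> B \<alpha> - B \<beta>" if "(c2, ([], {})) \<in> underS L x" for x
    proof
      assume "x \<in> B \<alpha> - B \<beta>"
      then obtain c l A where x: "x = (c, (l, A))" "(c, (l, A)) \<in> B \<alpha> - B \<beta>" by (cases x) auto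
      have "(c2, c) \<in> lam" using UL' that x(1) by blast
      then have "c1 \<in> underS lam c" by (rule underS_le_trans[OF wl c2])
      moreover have "c \<in> Field lam" using x(2) by (auto simp: B_def V_def)
      ultimately show False using below[OF x(2)] not_le_iff_underS[OF wl _ c1(1)] by blast
    qed
    moreover have "(c2, ([], {})) \<in> Field L" using underS_imp_Field(2)[OF c2] by (simp add: FL)
    ultimately show "\<not> cofinal (B \<alpha> - B \<beta>) L" unfolding cofinal_iff_underS by blast
  qed
  then show ?thesis by (rule is_dp3_sequence_ordIso[OF _ Liso])
qed

theorem theorem5p5:
  fixes \<kappa> :: "'k rel" and D :: "'k filter"
    and lams :: "'k \<Rightarrow> 'a rel" and lam :: "'b rel"
    and \<mu>s :: "'k \<Rightarrow> 'm rel" and \<mu> :: "'n rel"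
  assumes "card_order \<kappa>"
    and "D \<noteq> bot" and "aleph1_complete D"
    and "\<And>i. Card_order (lams i) \<and> infinite (Field (lams i)) \<and> regularCard (lams i)"
    and "\<And>i. cardSuc (ctwo ^c \<kappa>) <o lams i"
    and "\<And>A. A \<in> positive_sets D \<Longrightarrow> rank (filter_plus D A) lams =o lam"
    and "\<And>i. \<mu>s i <o dp3plus (lams i)"
    and "has_tcf D \<mu>s \<mu> \<or> (\<mu> <o Depth_plus D \<mu>s \<and> ctwo ^c \<kappa> <o \<mu>)"
  shows "\<mu> <o dp3plus lam"
proof -
  have wo: "Well_order (lams i)" for i using assms(4) by (simp add: card_order_on_def)
  have w\<mu>: "Well_order \<mu>"
    using assms(8) by (auto simp: has_tcf_def card_order_on_def ordLess_def)
  \<comment> \<open>Either alternative supplies an increasing sequence of length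
    \<open>\<mu>\<close>.\<close>
  obtain F where F: "is_increasing_sequence D \<mu>s \<mu> F"
    using assms(8) less_Depth_plusD[OF assms(2)] by (auto simp: has_tcf_def)
  obtain S where S: "\<And>i. is_dp3_sequence (lams i) (\<mu>s i) (S i)"
    using less_dp3plusD[OF assms(7)] by metis
  have "\<exists>B. is_dp3_sequence lam \<mu> B"
  proof (cases "\<exists>i. {i} \<in> positive_sets D")
    case True
    then obtain i where i: "{i} \<in> positive_sets D" ..
    have "lams i =o rank (filter_plus D {i}) lams"
      using rank_atom[OF assms(3) i wo] by (rule ordIso_symmetric)
    then have iso: "lams i =o lam" using assms(6)[OF i] by (rule ordIso_transitive)
    \<comment> \<open>What holds almost everywhere holds at the atom, so evaluation at
      \<open>i\<close> embeds \<open>\<mu>\<close> into \<open>\<mu>s i\<close>, and the sets for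
      \<open>lams i\<close> can be reindexed by \<open>\<mu>\<close>.\<close>
    have "F b i \<in> underS (\<mu>s i) (F a i)" if "b \<in> underS \<mu> a" for a b
    proof -
      have "eventually (\<lambda>j. (F b j, F a j) \<in> \<mu>s j \<and> F b j \<noteq> F a j) D"
        using F that by (auto simp: is_increasing_sequence_def prod_less_def underS_def)
      then have "eventually (\<lambda>j. (F b j, F a j) \<in> \<mu>s j \<and> F b j \<noteq> F a j) (filter_plus D {i})"
        using filter_plus_le[of D "{i}"] by (simp add: le_filter_def)
      then show ?thesis by (simp add: eventually_atom[OF i] underS_def)
    qed
    moreover have "Well_order (\<mu>s i)" using assms(7)[of i] by (auto simp: ordLess_def)
    moreover have "F a i \<in> Field (\<mu>s i)" if "a \<in> Field \<mu>" for a
      using F that by (auto simp: is_increasing_sequence_def ord_prod_def)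
    ultimately have "\<mu> \<le>o \<mu>s i" using w\<mu> by (intro ordLeq_if_strict_mono[where h = "\<lambda>a. F a i"])
    then obtain A where "is_dp3_sequence (lams i) \<mu> A"
      using is_dp3_sequence_reindex[OF S] by blast
    then show ?thesis using is_dp3_sequence_ordIso iso by blast
  next
    case False
    \<comment> \<open>Without atoms the complement of every singleton belongs to \<open>D\<close>;
      for a finite index set their intersection, the empty set, would too.\<close>
    have inf: "infinite (UNIV :: 'k set)"
    proof
      assume "finite (UNIV :: 'k set)"
      moreover have "eventually (\<lambda>j. j \<noteq> i) D" for i
        using False by (auto simp: positive_sets_def)
      ultimately have "eventually (\<lambda>j. \<forall>i. j \<noteq> i) D"
        using eventually_ball_finite[of UNIV "\<lambda>j i. j \<noteq> i" D] by simp
      then show False using assms(2) by (simp add: trivial_limit_def)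
    qed
    have "|UNIV :: 'k set set| <o lams i" for i
    proof -
      have \<kappa>: "Card_order \<kappa>" "Field \<kappa> = UNIV"
        using assms(1) card_order_on_Card_order by blast+
      have "|UNIV :: 'k set set| =o |Pow (Field \<kappa>)|"
        by (simp add: \<kappa>(2) card_of_refl)
      also have "|Pow (Field \<kappa>)| =o ctwo ^c \<kappa>"
        unfolding ctwo_def cexp_def Field_card_of by (rule card_of_Pow_Func)
      also have "ctwo ^c \<kappa> <o cardSuc (ctwo ^c \<kappa>)"
        by (rule cardSuc_greater[OF Card_order_cexp])
      also have "cardSuc (ctwo ^c \<kappa>) <o lams i" by (rule assms(5))
      finally show ?thesis .
    qed
    then show ?thesis
      using assms(4,6) S F by (intro ex_dp3_sequence_rank[OF inf assms(3,2)])
  qed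
  then show ?thesis using less_dp3plusI[OF w\<mu>] by blast
qed

end
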